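(* Let $N,\mu\ge1$ be integers and let the polytopic-uncertainty multistage setting described in the context be given: polytopes $\Delta_t=\mathrm{Conv}\{\chi_{ts}:1\le s\le d_t\}\subset\mathbf{R}^{\nu_t-1}$, matrices $A^{t\tau}\in\mathbf{R}^{m_t\times n_\tau}$ ($1\le\tau\le t\le N$), and poly-affine with memory $\mu$ right-hand sides $b_t(\zeta^t)=\sum_{\tau=1}^t\sum_{\varkappa\in\mathcal{I}_\tau}\big[\prod_{s=1}^\mu\lambda_{\varkappa_s}(\zeta_{\tau-\mu+s})\big]b^t_{\tau\varkappa}$ with $b^t_{\tau\varkappa}\in\mathbf{R}^{m_t}$. For a collection $v^N=\{v^t_{\tau\varkappa}\in\mathbf{R}^{n_t}:1\le\tau\le t\le N,\ \varkappa\in\mathcal{I}_\tau\}$ let $$x_t(\zeta^t)=\sum_{\tau=1}^t\sum_{\varkappa\in\mathcal{I}_\tau}\Big[\prod_{s=1}^\mu\lambda_{\varkappa_s}(\zeta_{\tau-\mu+s})\Big]v^t_{\tau\varkappa},\qquad t=1,\dots,N,$$ be the associated poly-affine with memory $\mu$ decision rules. Then: (i) The decision rules satisfy $$\sum_{\tau=1}^tA^{t\tau}x_\tau(\zeta^\tau)\le b_t(\zeta^t)\qquad\text{for all }t\in\{1,\dots,N\}\text{ and all }\zeta^N\in\Delta^N\qquad( * )$$ if and only if they satisfy these inequalities for all $t$ and all scenario trajectories $\zeta^N=(\chi_{1\xi_1},\dots,\chi_{N\xi_N})$, $\xi^N\in D^N$. (ii) Let $\mathcal{S}^+$ be the following system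 of linear constraints in the variables $v^N$, $u^t_{\tau\xi}\in\mathbf{R}^{n_t}$ and $y^t_{\tau\xi}\in\mathbf{R}^{m_t}$ ($1\le\tau\le t\le N$, $\xi\in D_{\tau-\mu+1:\tau}$), and $z$-variables with values in $\mathbf{R}^{m_t}$ (vector inequalities are entrywise): (a) $u^t_{\tau\xi}=\sum_{\varkappa\in\mathcal{I}_\tau}\big[\prod_{s=1}^\mu\lambda_{\varkappa_s}(\chi_{\tau-\mu+s,\xi_{\tau-\mu+s}})\big]v^t_{\tau\varkappa}$ for all $1\le\tau\le t\le N$, $\xi=(\xi_{\tau-\mu+1},\dots,\xi_\tau)\in D_{\tau-\mu+1:\tau}$; (b) $y^t_{s\xi}=\sum_{\tau=s}^tA^{t\tau}u^\tau_{s\xi}-\beta^t_{s\xi}$ for all $1\le s\le t\le N$, $\xi\in D_{s-\mu+1:s}$, where $\beta^t_{s\xi}=\sum_{\varkappa\in\mathcal{I}_s}\big[\prod_{r=1}^\mu\lambda_{\varkappa_r}(\chi_{s-\mu+r,\xi_{s-\mu+r}})\big]b^t_{s\varkappa}$; (c) if $\mu=1$: the $z$-variables are $z^t_s$, $1\le s\le t\le N$, and for every $t\in\{1,\dots,N\}$, with $z^t_{t+1}:=0$: $z^t_s\ge y^t_{s\xi}+z^t_{s+1}$ for all $\xi\in D_s$, $s=t,t-1,\dots,1$, and $z^t_1\le0$; (d) if $\mu\ge2$: the $z$-variables are $z^t_{s\eta}$, $1\le s\le t\le N$, $\eta\in D_{s-\mu+1:s-1}$, and for every $t\in\{1,\dots,N\}$: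 $z^t_{t\,\xi_{t-\mu+1:t-1}}\ge y^t_{t\,\xi_{t-\mu+1:t}}$ for all $\xi_{t-\mu+1:t}\in D_{t-\mu+1:t}$; $z^t_{s\,\xi_{s-\mu+1:s-1}}\ge y^t_{s\,\xi_{s-\mu+1:s}}+z^t_{(s+1)\,\xi_{s-\mu+2:s}}$ for all $\xi_{s-\mu+1:s}\in D_{s-\mu+1:s}$, $s=t-1,\dots,1$; and $z^t_{1\,\xi_{2-\mu:0}}\le0$. Then $v^N$ satisfies $( * )$ if and only if $v^N$ can be extended, by suitable values of the $u$-, $y$- and $z$-variables, to a feasible solution of $\mathcal{S}^+$. Consequently, for a convex objective $f(v^N)$, minimizing $f(v^N)$ over the poly-affine with memory $\mu$ decision rules satisfying $( * )$ is equivalent to minimizing $f(v^N)$ over all $(v,u,y,z)$ satisfying the linear system $\mathcal{S}^+$. (iii) If $d_t\le d$, $m_t\le m$ and $n_t\le n$ for all $t$, then the total number of scalar variables and the total number of scalar constraints in $\mathcal{S}^+$ do not exceed $C(m+n)N^2d^\mu$, where $C$ is an absolute constant.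
   Context: Setting. The uncertainty at stage $t\in\{1,\dots,N\}$ is a vector $\zeta_t$ in the polytope $\Delta_t=\mathrm{Conv}\{\chi_{ts}:1\le s\le d_t\}\subset\mathbf{R}^{\nu_t-1}$, where $d_t\ge1$ and the scenarios $\chi_{t1},\dots,\chi_{td_t}$ affinely span $\mathbf{R}^{\nu_t-1}$ (so $\nu_t\le d_t$). Write $\Delta^t=\Delta_1\times\dots\times\Delta_t$, $\zeta^t=(\zeta_1,\dots,\zeta_t)\in\Delta^t$; for $\zeta^N\in\Delta^N$, $\zeta^t$ is its initial fragment of length $t$. Decisions at stage $t$ are vectors $x_t=x_t(\zeta^t)\in\mathbf{R}^{n_t}$. Let $D_t=\{1,\dots,d_t\}$, $D^t=D_1\times\dots\times D_t$, $D_{p:q}=D_p\times\dots\times D_q$, $\xi_{p:q}=(\xi_p,\dots,\xi_q)$. Conventions for indices $s\le0$: $\Delta_s=\{0\}=\mathbf{R}^0$, $\zeta_s=0$, $\nu_s=d_s=1$, $D_s=\{1\}$, $\xi_s=1$, $\chi_{s1}=0$. For $1\le t\le N$, fix an affine basis of $\mathbf{R}^{\nu_t-1}$ and let $\lambda(\zeta_t)=(\lambda_1(\zeta_t),\dots,\lambda_{\nu_t}(\zeta_t))\in\mathbf{R}^{\nu_t}$ be the (barycentric) coordinates of $\zeta_t\in\mathbf{R}^{\nu_t-1}$ in this affine basis (they are affine in $\zeta_t$ and sum to $1$); for $t\le0$, $\lambda_1(\zeta_t)\equiv1$. Let $\mathcal{I}_\tau=\{\varkappa=(\varkappa_1,\dots,\varkappa_\mu):1\le\varkappa_s\le\nu_{\tau-\mu+s},\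 1\le s\le\mu\}$. A function $g:\Delta^t\to\mathbf{R}^\nu$ is poly-affine with memory $\mu$ if $g(\zeta_1,\dots,\zeta_t)=\sum_{\tau=1}^tg_\tau(\zeta_{\tau-\mu+1},\dots,\zeta_\tau)$ where every $g_\tau$ takes values in $\mathbf{R}^\nu$ and is affine in each of its arguments $\zeta_{\tau-\mu+1},\dots,\zeta_\tau$; equivalently $g(\zeta^t)=\sum_{\tau=1}^t\sum_{\varkappa\in\mathcal{I}_\tau}\big[\prod_{s=1}^\mu\lambda_{\varkappa_s}(\zeta_{\tau-\mu+s})\big]g_{\tau\varkappa}$ for some coefficients $g_{\tau\varkappa}\in\mathbf{R}^\nu$. *)

theory Defs
  imports "HOL-Analysis.Analysis" "HOL-Analysis.Finite_Function_Topology"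
begin

text \<open>
  All dimensions vary with the stage, so coordinate spaces are realised inside the library's real
  vector space of finitely supported functions: \<open>coord_space I\<close> is the space of real vectors with
  coordinates indexed by \<open>I\<close>, and \<open>Rn n\<close> is Euclidean \<open>n\<close>-space. Stages are integers because
  memory windows reach back to indices \<open>\<le> 0\<close>.
\<close>

definition coord_space :: "'i set \<Rightarrow> ('i \<Rightarrow>\<^sub>0 real) set" where
  "coord_space I = {x. Poly_Mapping.keys x \<subseteq> I}"

abbreviation Rn :: "nat \<Rightarrow> (nat \<Rightarrow>\<^sub>0 real) set" where
  "Rn n \<equiv> coord_space {..<n}"

definition coord_proj :: "'i set \<Rightarrow> ('i \<Rightarrow>\<^sub>0 real) \<Rightarrow> ('i \<Rightarrow>\<^sub>0 real)" where
  "coord_proj I x = (\<Sum>k\<in>I. Poly_Mapping.single k (Poly_Mapping.lookup x k))"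

type_synonym point = "nat \<Rightarrow>\<^sub>0 real"
type_synonym trajectory = "int \<Rightarrow> point"

text \<open>
  A multi-index is a function of the position. An element of \<open>D_{p:q}\<close> is indexed by absolute
  stages \<open>p..q\<close>, so its fragments are restrictions; an element of \<open>I_\<tau>\<close> by positions \<open>1..\<mu>\<close>.
\<close>

type_synonym midx = "int \<Rightarrow> nat"

text \<open>
  \<open>Amat S t \<tau> i j\<close> is entry \<open>(i, j)\<close> of \<open>A^{t\<tau>}\<close>, \<open>bcoef S t \<tau> \<kappa> i\<close> is entry \<open>i\<close> of \<open>b^t_{\<tau>\<kappa>}\<close>
  (rows and columns count from 0), and \<open>abasis S t 1, ..., abasis S t (\<nu>_t)\<close> is the fixed affine
  basis used at stage \<open>t\<close>.
\<close>

record setting =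
  horizon :: nat
  memory :: nat
  nu :: "int \<Rightarrow> nat"
  nscen :: "int \<Rightarrow> nat"
  xdim :: "int \<Rightarrow> nat"
  cdim :: "int \<Rightarrow> nat"
  chi :: "int \<Rightarrow> nat \<Rightarrow> point"
  abasis :: "int \<Rightarrow> nat \<Rightarrow> point"
  Amat :: "int \<Rightarrow> int \<Rightarrow> nat \<Rightarrow> nat \<Rightarrow> real"
  bcoef :: "int \<Rightarrow> int \<Rightarrow> midx \<Rightarrow> nat \<Rightarrow> real"

abbreviation N_of :: "setting \<Rightarrow> int" where "N_of S \<equiv> int (horizon S)"
abbreviation mu_of :: "setting \<Rightarrow> int" where "mu_of S \<equiv> int (memory S)"

definition valid_setting :: "setting \<Rightarrow> bool" where
  "valid_setting S \<longleftrightarrow>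
     horizon S \<ge> 1 \<and> memory S \<ge> 1 \<and>
     (\<forall>t\<in>{1..N_of S}.
        nu S t \<ge> 1 \<and> nscen S t \<ge> 1 \<and>
        affine hull (chi S t ` {1..nscen S t}) = Rn (nu S t - 1) \<and>
        inj_on (abasis S t) {1..nu S t} \<and>
        \<not> affine_dependent (abasis S t ` {1..nu S t}) \<and>
        affine hull (abasis S t ` {1..nu S t}) = Rn (nu S t - 1)) \<and>
     (\<forall>t\<le>0. nu S t = 1 \<and> nscen S t = 1 \<and> chi S t 1 = 0)"

definition Delta :: "setting \<Rightarrow> int \<Rightarrow> point set" where
  "Delta S t = convex hull (chi S t ` {1..nscen S t})"

definition Dset :: "setting \<Rightarrow> int \<Rightarrow> int \<Rightarrow> midx set" where
  "Dset S p q = (\<Pi>\<^sub>E s\<in>{p..q}. {1..nscen S s})"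

definition Idx :: "setting \<Rightarrow> int \<Rightarrow> midx set" where
  "Idx S \<tau> = (\<Pi>\<^sub>E s\<in>{1..mu_of S}. {1..nu S (\<tau> - mu_of S + s)})"

definition trajectories :: "setting \<Rightarrow> trajectory set" where
  "trajectories S = (\<Pi>\<^sub>E t\<in>{1..N_of S}. Delta S t)"

definition scen :: "setting \<Rightarrow> midx \<Rightarrow> trajectory" where
  "scen S \<xi> = (\<lambda>r. chi S r (\<xi> r))"

definition scenario_trajectories :: "setting \<Rightarrow> trajectory set" where
  "scenario_trajectories S = (\<lambda>\<xi>. restrict (scen S \<xi>) {1..N_of S}) ` Dset S 1 (N_of S)"

definition barycentric :: "setting \<Rightarrow> int \<Rightarrow> point \<Rightarrow> nat \<Rightarrow> real" where
  "barycentric S t x =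
     (THE c. c \<in> extensional {1..nu S t} \<and> (\<Sum>k=1..nu S t. c k) = 1 \<and>
             (\<Sum>k=1..nu S t. c k *\<^sub>R abasis S t k) = x)"

definition lam :: "setting \<Rightarrow> int \<Rightarrow> nat \<Rightarrow> point \<Rightarrow> real" where
  "lam S t k x = (if t \<le> 0 then 1 else barycentric S t x k)"

definition wt :: "setting \<Rightarrow> int \<Rightarrow> midx \<Rightarrow> trajectory \<Rightarrow> real" where
  "wt S \<tau> \<kappa> \<zeta> =
     (\<Prod>s=1..mu_of S. lam S (\<tau> - mu_of S + s) (\<kappa> s) (\<zeta> (\<tau> - mu_of S + s)))"

text \<open>
  Scalar variables: \<open>V t \<tau> \<kappa> i\<close> is entry \<open>i\<close> of \<open>v^t_{\<tau>\<kappa>}\<close>, and so on; the \<open>z\<close>-variables are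
  \<open>Z1 t s i\<close> when \<open>\<mu> = 1\<close> and \<open>Z t s \<eta> i\<close> when \<open>\<mu> \<ge> 2\<close>.
\<close>

datatype svar =
    V int int midx nat
  | U int int midx nat
  | Y int int midx nat
  | Z1 int int nat
  | Z int int midx nat

definition vvars :: "setting \<Rightarrow> svar set" where
  "vvars S = {V t \<tau> \<kappa> i | t \<tau> \<kappa> i.
     1 \<le> \<tau> \<and> \<tau> \<le> t \<and> t \<le> N_of S \<and> \<kappa> \<in> Idx S \<tau> \<and> i < xdim S t}"

definition uvars :: "setting \<Rightarrow> svar set" where
  "uvars S = {U t \<tau> \<xi> i | t \<tau> \<xi> i.
     1 \<le> \<tau> \<and> \<tau> \<le> t \<and> t \<le> N_of S \<and> \<xi> \<in> Dset S (\<tau> - mu_of S + 1) \<tau> \<and> i < xdim S t}"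

definition yvars :: "setting \<Rightarrow> svar set" where
  "yvars S = {Y t s \<xi> i | t s \<xi> i.
     1 \<le> s \<and> s \<le> t \<and> t \<le> N_of S \<and> \<xi> \<in> Dset S (s - mu_of S + 1) s \<and> i < cdim S t}"

definition zvars :: "setting \<Rightarrow> svar set" where
  "zvars S =
     (if memory S = 1
      then {Z1 t s i | t s i. 1 \<le> s \<and> s \<le> t \<and> t \<le> N_of S \<and> i < cdim S t}
      else {Z t s \<eta> i | t s \<eta> i.
              1 \<le> s \<and> s \<le> t \<and> t \<le> N_of S \<and> \<eta> \<in> Dset S (s - mu_of S + 1) (s - 1) \<and> i < cdim S t})"

definition svars :: "setting \<Rightarrow> svar set" where
  "svars S = vvars S \<union> uvars S \<union> yvars S \<union> zvars S"

definition decision :: "setting \<Rightarrow> (svar \<Rightarrow>\<^sub>0 real) \<Rightarrow> int \<Rightarrow> trajectory \<Rightarrow> nat \<Rightarrow> real" where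
  "decision S v t \<zeta> i =
     (\<Sum>\<tau>=1..t. \<Sum>\<kappa>\<in>Idx S \<tau>. wt S \<tau> \<kappa> \<zeta> * Poly_Mapping.lookup v (V t \<tau> \<kappa> i))"

definition rhs :: "setting \<Rightarrow> int \<Rightarrow> trajectory \<Rightarrow> nat \<Rightarrow> real" where
  "rhs S t \<zeta> i = (\<Sum>\<tau>=1..t. \<Sum>\<kappa>\<in>Idx S \<tau>. wt S \<tau> \<kappa> \<zeta> * bcoef S t \<tau> \<kappa> i)"

definition satisfies_on :: "setting \<Rightarrow> (svar \<Rightarrow>\<^sub>0 real) \<Rightarrow> trajectory set \<Rightarrow> bool" where
  "satisfies_on S v T \<longleftrightarrow>
     (\<forall>t\<in>{1..N_of S}. \<forall>\<zeta>\<in>T. \<forall>i<cdim S t.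
        (\<Sum>\<tau>=1..t. \<Sum>j<xdim S \<tau>. Amat S t \<tau> i j * decision S v \<tau> \<zeta> j) \<le> rhs S t \<zeta> i)"

text \<open>
  The system is kept as data, a finite family of scalar linear constraints, so that its constraints
  can be counted. A linear form is a finitely supported coefficient vector; the form
  \<open>single x c\<close> is \<open>c\<close> times the variable \<open>x\<close>.
\<close>

datatype lincon =
    Lin_eq "svar \<Rightarrow>\<^sub>0 real" real
  | Lin_le "svar \<Rightarrow>\<^sub>0 real" real

definition form_val :: "(svar \<Rightarrow>\<^sub>0 real) \<Rightarrow> (svar \<Rightarrow>\<^sub>0 real) \<Rightarrow> real" where
  "form_val a w =
     (\<Sum>x\<in>Poly_Mapping.keys a. Poly_Mapping.lookup a x * Poly_Mapping.lookup w x)"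

fun sat :: "(svar \<Rightarrow>\<^sub>0 real) \<Rightarrow> lincon \<Rightarrow> bool" where
  "sat w (Lin_eq a r) \<longleftrightarrow> form_val a w = r"
| "sat w (Lin_le a r) \<longleftrightarrow> form_val a w \<le> r"

abbreviation var :: "svar \<Rightarrow> (svar \<Rightarrow>\<^sub>0 real)" where
  "var x \<equiv> Poly_Mapping.single x 1"

text \<open>
  Labels of the scalar constraints: \<open>Def_u\<close>, \<open>Def_y\<close> for the equations, \<open>Rec1\<close>, \<open>End1\<close> for the
  \<open>z\<close>-inequalities when \<open>\<mu> = 1\<close>, and \<open>Last\<close>, \<open>Rec\<close>, \<open>End\<close> for those when \<open>\<mu> \<ge> 2\<close>. Distinct labels
  count separately even if they happen to carry the same inequality.
\<close>

datatype label =
    Def_u int int midx nat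
  | Def_y int int midx nat
  | Rec1 int int midx nat
  | End1 int nat
  | Last int midx nat
  | Rec int int midx nat
  | End int midx nat

definition beta :: "setting \<Rightarrow> int \<Rightarrow> int \<Rightarrow> midx \<Rightarrow> nat \<Rightarrow> real" where
  "beta S t s \<xi> i = (\<Sum>\<kappa>\<in>Idx S s. wt S s \<kappa> (scen S \<xi>) * bcoef S t s \<kappa> i)"

fun constr :: "setting \<Rightarrow> label \<Rightarrow> lincon" where
  "constr S (Def_u t \<tau> \<xi> i) =
     Lin_eq (var (U t \<tau> \<xi> i)
             - (\<Sum>\<kappa>\<in>Idx S \<tau>. Poly_Mapping.single (V t \<tau> \<kappa> i) (wt S \<tau> \<kappa> (scen S \<xi>)))) 0"
| "constr S (Def_y t s \<xi> i) =
     Lin_eq (var (Y t s \<xi> i)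
             - (\<Sum>\<tau>=s..t. \<Sum>j<xdim S \<tau>. Poly_Mapping.single (U \<tau> s \<xi> j) (Amat S t \<tau> i j)))
            (- beta S t s \<xi> i)"
| "constr S (Rec1 t s \<xi> i) =
     Lin_le (var (Y t s \<xi> i) + (if s = t then 0 else var (Z1 t (s + 1) i)) - var (Z1 t s i)) 0"
| "constr S (End1 t i) = Lin_le (var (Z1 t 1 i)) 0"
| "constr S (Last t \<xi> i) =
     Lin_le (var (Y t t \<xi> i) - var (Z t t (restrict \<xi> {t - mu_of S + 1..t - 1}) i)) 0"
| "constr S (Rec t s \<xi> i) =
     Lin_le (var (Y t s \<xi> i) + var (Z t (s + 1) (restrict \<xi> {s - mu_of S + 2..s}) i)
             - var (Z t s (restrict \<xi> {s - mu_of S + 1..s - 1}) i)) 0"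
| "constr S (End t \<eta> i) = Lin_le (var (Z t 1 \<eta> i)) 0"

definition labels :: "setting \<Rightarrow> label set" where
  "labels S =
     {Def_u t \<tau> \<xi> i | t \<tau> \<xi> i.
        1 \<le> \<tau> \<and> \<tau> \<le> t \<and> t \<le> N_of S \<and> \<xi> \<in> Dset S (\<tau> - mu_of S + 1) \<tau> \<and> i < xdim S t}
   \<union> {Def_y t s \<xi> i | t s \<xi> i.
        1 \<le> s \<and> s \<le> t \<and> t \<le> N_of S \<and> \<xi> \<in> Dset S (s - mu_of S + 1) s \<and> i < cdim S t}
   \<union> (if memory S = 1
      then {Rec1 t s \<xi> i | t s \<xi> i.
              1 \<le> s \<and> s \<le> t \<and> t \<le> N_of S \<and> \<xi> \<in> Dset S s s \<and> i < cdim S t}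
         \<union> {End1 t i | t i. 1 \<le> t \<and> t \<le> N_of S \<and> i < cdim S t}
      else {Last t \<xi> i | t \<xi> i.
              1 \<le> t \<and> t \<le> N_of S \<and> \<xi> \<in> Dset S (t - mu_of S + 1) t \<and> i < cdim S t}
         \<union> {Rec t s \<xi> i | t s \<xi> i.
              1 \<le> s \<and> s \<le> t - 1 \<and> t \<le> N_of S \<and> \<xi> \<in> Dset S (s - mu_of S + 1) s \<and> i < cdim S t}
         \<union> {End t \<eta> i | t \<eta> i.
              1 \<le> t \<and> t \<le> N_of S \<and> \<eta> \<in> Dset S (2 - mu_of S) 0 \<and> i < cdim S t})"

definition feasible :: "setting \<Rightarrow> (svar \<Rightarrow>\<^sub>0 real) \<Rightarrow> bool" where
  "feasible S w \<longleftrightarrow> w \<in> coord_space (svars S) \<and> (\<forall>l\<in>labels S. sat w (constr S l))"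

definition robust :: "setting \<Rightarrow> (svar \<Rightarrow>\<^sub>0 real) \<Rightarrow> bool" where
  "robust S v \<longleftrightarrow> v \<in> coord_space (vvars S) \<and> satisfies_on S v (trajectories S)"

end

theory Submission
  imports Defs
begin

text \<open>
  Each stage vector enters the excess of a constraint over its right-hand side affinely when the
  others are fixed, so its maximum over a product of polytopes is attained at vertices; replacing
  the stages one at a time yields (i). Along a scenario trajectory the excess at stage \<open>t\<close>
  splits into stage costs \<open>y\<^sup>t\<^sub>s\<close> that depend on the last \<open>\<mu>\<close> scenario indices only.
  Maximizing such a sum by dynamic programming needs a cost-to-go depending on \<open>\<mu> - 1\<close>
  indices, and its Bellman inequalities are the \<open>z\<close>-constraints. Thus the robust feasible set is
  the projection of the feasible set of the linear system. The size bound uses \<open>\<nu>\<^sub>t \<le> d\<^sub>t\<close>: an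
  affinely independent set is no larger than a set whose affine hull contains it.
\<close>

section \<open>Linear forms, projections and barycentric coordinates\<close>

text \<open>Coordinates outside the support contribute zero, so forms with different supports can be
  evaluated over one common finite index set.\<close>

lemma form_val_superset:
  assumes "finite A" "Poly_Mapping.keys a \<subseteq> A"
  shows "form_val a w = (\<Sum>x\<in>A. Poly_Mapping.lookup a x * Poly_Mapping.lookup w x)"
  unfolding form_val_def
  by (rule sum.mono_neutral_left) (use assms in \<open>auto simp: in_keys_iff\<close>)

lemma form_val_add: "form_val (a + b) w = form_val a w + form_val b w"
proof -
  let ?A = "Poly_Mapping.keys a \<union> Poly_Mapping.keys b"
  have "Poly_Mapping.keys (a + b) \<subseteq> ?A"
    by (rule Poly_Mapping.keys_add)
  then show ?thesis
    by (simp add: form_val_superset[of ?A] lookup_add algebra_simps sum.distrib)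
qed

lemma form_val_zero [simp]: "form_val 0 w = 0"
  by (simp add: form_val_def)

lemma form_val_diff: "form_val (a - b) w = form_val a w - form_val b w"
  using form_val_add[of "a - b" b w] by simp

lemma form_val_sum: "form_val (sum a I) w = (\<Sum>k\<in>I. form_val (a k) w)"
  by (induction I rule: infinite_finite_induct) (auto simp: form_val_add)

lemma form_val_single [simp]:
  "form_val (Poly_Mapping.single x c) w = c * Poly_Mapping.lookup w x"
  by (simp add: form_val_superset[of "{x}"])

lemmas form_val_simps = form_val_add form_val_diff form_val_sum

lemma lookup_coord_proj:
  assumes "finite I"
  shows "Poly_Mapping.lookup (coord_proj I w) x = (if x \<in> I then Poly_Mapping.lookup w x else 0)"
  using assms by (simp add: coord_proj_def lookup_sum lookup_single when_def)

lemma coord_proj_in_coord_space: "finite I \<Longrightarrow> coord_proj I w \<in> coord_space I"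
  by (auto simp: coord_space_def in_keys_iff lookup_coord_proj split: if_splits)

text \<open>A vector of \<open>coord_space I\<close> vanishes off \<open>I\<close>. This turns the
  extension of \<open>v\<close> to \<open>w\<close> into a single projection equation.\<close>

lemma coord_proj_eq_iff:
  assumes "finite I" "v \<in> coord_space I"
  shows "coord_proj I w = v \<longleftrightarrow> (\<forall>x\<in>I. Poly_Mapping.lookup w x = Poly_Mapping.lookup v x)"
proof -
  have "Poly_Mapping.lookup v x = 0" if "x \<notin> I" for x
    using assms(2) that by (auto simp: coord_space_def in_keys_iff)
  then show ?thesis
    using assms(1) by (auto simp: poly_mapping_eq_iff fun_eq_iff lookup_coord_proj)
qed

text \<open>Otherwise the differences \<open>c k - c' k\<close>, carried over to the points by the
  inverse of \<open>e\<close>, sum to zero, combine to zero and are not all zero: an affine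
  dependence.\<close>

lemma affine_coordinates_unique:
  fixes e :: "'i \<Rightarrow> 'a::real_vector"
  assumes "finite I" "inj_on e I" "\<not> affine_dependent (e ` I)"
    and "sum c I = sum c' I" "(\<Sum>k\<in>I. c k *\<^sub>R e k) = (\<Sum>k\<in>I. c' k *\<^sub>R e k)" "k \<in> I"
  shows "c k = c' k"
proof (rule ccontr)
  assume neq: "c k \<noteq> c' k"
  define U where "U = (\<lambda>x. c (the_inv_into I e x) - c' (the_inv_into I e x))"
  have U: "U (e j) = c j - c' j" if "j \<in> I" for j
    using that assms(2) by (simp add: U_def the_inv_into_f_f)
  have "sum U (e ` I) = 0" "(\<Sum>x\<in>e ` I. U x *\<^sub>R x) = 0"
    using assms(4,5)
    by (simp_all add: sum.reindex[OF assms(2)] U sum_subtractf scaleR_left_diff_distrib)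
  moreover have "U (e k) \<noteq> 0"
    using neq U assms(6) by simp
  ultimately have "affine_dependent (e ` I)"
    using assms(1,6) by (subst affine_dependent_explicit_finite) auto
  then show False
    using assms(3) by contradiction
qed

lemma affine_coordinates_exist:
  fixes e :: "'i \<Rightarrow> 'a::real_vector"
  assumes "finite I" "inj_on e I" "x \<in> affine hull (e ` I)"
  obtains c where "sum c I = 1" "(\<Sum>k\<in>I. c k *\<^sub>R e k) = x"
proof -
  from assms(3) obtain u where "sum u (e ` I) = 1" "(\<Sum>y\<in>e ` I. u y *\<^sub>R y) = x"
    using assms(1) by (subst (asm) affine_hull_finite) auto
  then show ?thesis
    by (intro that[of "u \<circ> e"]) (simp_all add: sum.reindex[OF assms(2)])
qed

text \<open>Shifting one point of each set to the origin turns affine independence into linear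
  independence and the affine hull into a translated span, where the cardinality bound for
  independent sets applies.\<close>

lemma affine_independent_card_le:
  fixes A B :: "'a::real_vector set"
  assumes "finite B" "\<not> affine_dependent A" "A \<subseteq> affine hull B"
  shows "card A \<le> card B"
proof (cases "A = {}")
  case False
  then obtain a where a: "a \<in> A" by blast
  let ?f = "\<lambda>x. - a + x"
  have "B \<noteq> {}"
    using a assms(3) by auto
  then obtain b where b: "b \<in> B" by blast
  let ?g = "\<lambda>x. - b + x"
  have hull: "affine hull B = (\<lambda>x. b + x) ` span (?g ` (B - {b}))"
    by (rule affine_hull_span2[OF b])
  have ind: "independent (?f ` (A - {a}))"
    using assms(2) a by (simp add: affine_dependent_iff_dependent2)
  have sp: "?f ` (A - {a}) \<subseteq> span (?g ` (B - {b}))"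
  proof
    fix y assume "y \<in> ?f ` (A - {a})"
    then obtain x where x: "x \<in> A" "y = - a + x" by auto
    from x(1) assms(3) obtain p where p: "x = b + p" "p \<in> span (?g ` (B - {b}))"
      unfolding hull by auto
    from a assms(3) obtain q where q: "a = b + q" "q \<in> span (?g ` (B - {b}))"
      unfolding hull by auto
    \<comment> \<open>The base points of \<open>A\<close> and \<open>B\<close> may differ:
      \<open>x - a = (x - b) - (a - b)\<close>, and both differences lie in the span.\<close>
    have "y = p - q"
      using x p q by simp
    then show "y \<in> span (?g ` (B - {b}))"
      using p q span_diff by blast
  qed
  have fin: "finite (?g ` (B - {b}))"
    using assms(1) by simp
  have le: "card (?f ` (A - {a})) \<le> card (?g ` (B - {b}))"
    and finA: "finite (?f ` (A - {a}))"
    using independent_span_bound[OF fin ind sp] by auto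
  have inj: "inj_on (\<lambda>x. - c + x) X" for c :: 'a and X
    by (simp add: inj_on_def)
  have "finite A"
    using finA finite_imageD[OF _ inj] by (metis finite_Diff_insert finite.emptyI Diff_empty)
  have "card (A - {a}) \<le> card (B - {b})"
    using le by (simp only: card_image[OF inj])
  then show ?thesis
    using a b assms(1) \<open>finite A\<close> by (metis card.remove Suc_le_mono)
qed simp

section \<open>Barycentric coordinates and dimension bounds in a valid setting\<close>

context
  fixes S :: setting
  assumes valid: "valid_setting S"
begin

lemma valid_horizon: "horizon S \<ge> 1" and valid_memory: "memory S \<ge> 1"
  using valid by (auto simp: valid_setting_def)

lemma valid_nscen: "t \<le> N_of S \<Longrightarrow> nscen S t \<ge> 1"
  using valid unfolding valid_setting_def by (cases "t \<ge> 1") force+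

lemma valid_nonpos: "t \<le> 0 \<Longrightarrow> nscen S t = 1" "t \<le> 0 \<Longrightarrow> nu S t = 1"
  using valid by (auto simp: valid_setting_def)

lemma valid_basis:
  assumes "t \<in> {1..N_of S}"
  shows "inj_on (abasis S t) {1..nu S t}"
    "\<not> affine_dependent (abasis S t ` {1..nu S t})"
    "affine hull (abasis S t ` {1..nu S t}) = Rn (nu S t - 1)"
    "affine hull (chi S t ` {1..nscen S t}) = Rn (nu S t - 1)"
  using valid assms by (auto simp: valid_setting_def)

lemma affine_Rn:
  assumes "t \<in> {1..N_of S}" "x \<in> Rn (nu S t - 1)" "y \<in> Rn (nu S t - 1)" "a + b = 1"
  shows "a *\<^sub>R x + b *\<^sub>R y \<in> Rn (nu S t - 1)"
  using mem_affine[OF affine_affine_hull, of x "abasis S t ` {1..nu S t}" y a b]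
    assms valid_basis(3)[OF assms(1)] by simp

text \<open>Justifies the definite description behind \<open>barycentric\<close>: existence holds
  because the basis affinely spans the space, uniqueness by affine independence, and extensionality
  fixes the values outside the index range.\<close>

lemma barycentric_coordinates:
  assumes t: "t \<in> {1..N_of S}" and x: "x \<in> Rn (nu S t - 1)"
  shows "(\<Sum>k=1..nu S t. barycentric S t x k) = 1"
    "(\<Sum>k=1..nu S t. barycentric S t x k *\<^sub>R abasis S t k) = x"
proof -
  note basis = valid_basis[OF t]
  let ?P = "\<lambda>c. c \<in> extensional {1..nu S t} \<and> (\<Sum>k=1..nu S t. c k) = (1::real) \<and>
    (\<Sum>k=1..nu S t. c k *\<^sub>R abasis S t k) = x"
  obtain c where "sum c {1..nu S t} = 1" "(\<Sum>k=1..nu S t. c k *\<^sub>R abasis S t k) = x"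
    using affine_coordinates_exist[of "{1..nu S t}" "abasis S t" x] basis x by auto
  then have "?P (restrict c {1..nu S t})"
    by simp
  moreover have "c1 = c2" if "?P c1" "?P c2" for c1 c2
  proof (rule extensionalityI)
    note c = conjunct1[OF that(1)] conjunct1[OF that(2)]
    note c_sum = conjunct1[OF conjunct2[OF that(1)]] conjunct1[OF conjunct2[OF that(2)]]
    note c_comb = conjunct2[OF conjunct2[OF that(1)]] conjunct2[OF conjunct2[OF that(2)]]
    show "c1 \<in> extensional {1..nu S t}" "c2 \<in> extensional {1..nu S t}"
      by (fact c)+
    show "c1 k = c2 k" if "k \<in> {1..nu S t}" for k
      by (rule affine_coordinates_unique[OF _ basis(1,2) trans[OF c_sum(1) c_sum(2)[symmetric]]
            trans[OF c_comb(1) c_comb(2)[symmetric]] that]) simp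
  qed
  ultimately have "\<exists>!c. ?P c"
    by blast
  from theI'[OF this, folded barycentric_def]
  show "(\<Sum>k=1..nu S t. barycentric S t x k) = 1"
    "(\<Sum>k=1..nu S t. barycentric S t x k *\<^sub>R abasis S t k) = x"
    by auto
qed

text \<open>The combined coordinates of \<open>x\<close> and \<open>y\<close> also sum to 1 and
  represent the combined point, so uniqueness of coordinates identifies them.\<close>

lemma lam_affine:
  assumes t: "t \<in> {1..N_of S}" and xy: "x \<in> Rn (nu S t - 1)" "y \<in> Rn (nu S t - 1)"
    and ab: "a + b = 1" and k: "k \<in> {1..nu S t}"
  shows "lam S t k (a *\<^sub>R x + b *\<^sub>R y) = a * lam S t k x + b * lam S t k y"
proof -
  note basis = valid_basis[OF t]
  let ?B = "barycentric S t"
  note X = barycentric_coordinates[OF t xy(1)] and Y = barycentric_coordinates[OF t xy(2)]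
    and Z = barycentric_coordinates[OF t affine_Rn[OF t xy ab]]
  have "?B (a *\<^sub>R x + b *\<^sub>R y) k = (\<lambda>k. a * ?B x k + b * ?B y k) k"
  proof (rule affine_coordinates_unique[OF _ basis(1,2) _ _ k])
    show "sum (?B (a *\<^sub>R x + b *\<^sub>R y)) {1..nu S t} = (\<Sum>k=1..nu S t. a * ?B x k + b * ?B y k)"
      using X Y Z ab by (simp add: sum.distrib flip: sum_distrib_left)
    have "(\<Sum>k=1..nu S t. (a * ?B x k + b * ?B y k) *\<^sub>R abasis S t k) =
      a *\<^sub>R (\<Sum>k=1..nu S t. ?B x k *\<^sub>R abasis S t k) + b *\<^sub>R (\<Sum>k=1..nu S t. ?B y k *\<^sub>R abasis S t k)"
      by (simp add: scaleR_left_distrib sum.distrib scaleR_sum_right)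
    then show "(\<Sum>k=1..nu S t. ?B (a *\<^sub>R x + b *\<^sub>R y) k *\<^sub>R abasis S t k) =
      (\<Sum>k=1..nu S t. (a * ?B x k + b * ?B y k) *\<^sub>R abasis S t k)"
      using X Y Z by simp
  qed simp
  then show ?thesis
    using t by (simp add: lam_def)
qed

text \<open>Lets \<open>d\<close> bound the index sets of the \<open>v\<close>-variables too. At
  nonpositive stages both numbers are 1 by convention.\<close>

lemma nu_le_nscen: "t \<le> N_of S \<Longrightarrow> nu S t \<le> nscen S t"
proof (cases "t \<ge> 1")
  case True
  assume "t \<le> N_of S"
  then have t: "t \<in> {1..N_of S}" using True by simp
  note basis = valid_basis[OF t]
  have "nu S t = card (abasis S t ` {1..nu S t})"
    using card_image[OF basis(1)] by simp
  also have "\<dots> \<le> card (chi S t ` {1..nscen S t})"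
    using basis hull_subset[of "abasis S t ` {1..nu S t}" affine]
    by (intro affine_independent_card_le) auto
  also have "\<dots> \<le> nscen S t"
    using card_image_le[of "{1..nscen S t}" "chi S t"] by simp
  finally show ?thesis .
qed (simp add: valid_nonpos)

end

section \<open>Reduction to scenario trajectories\<close>

text \<open>Affinity is asked only for \<open>x\<close> and \<open>y\<close> in the stage space,
  where barycentric coordinates are meaningful; the other stages of \<zeta> stay arbitrary.\<close>

definition stage_affine :: "setting \<Rightarrow> int \<Rightarrow> (trajectory \<Rightarrow> real) \<Rightarrow> bool" where
  "stage_affine S r G \<longleftrightarrow> (\<forall>\<zeta> x y a b. x \<in> Rn (nu S r - 1) \<longrightarrow> y \<in> Rn (nu S r - 1) \<longrightarrow> a + b = 1 \<longrightarrow>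
     G (\<zeta>(r := a *\<^sub>R x + b *\<^sub>R y)) = a * G (\<zeta>(r := x)) + b * G (\<zeta>(r := y)))"

lemma stage_affine_sum:
  assumes "\<And>k. k \<in> I \<Longrightarrow> stage_affine S r (G k)"
  shows "stage_affine S r (\<lambda>\<zeta>. \<Sum>k\<in>I. G k \<zeta>)"
  using assms by (simp add: stage_affine_def sum.distrib sum_distrib_left)

lemma stage_affine_cmult:
  "stage_affine S r G \<Longrightarrow> stage_affine S r (\<lambda>\<zeta>. c * G \<zeta>)"
  unfolding stage_affine_def by (auto simp: algebra_simps)

lemma stage_affine_diff:
  assumes "stage_affine S r F" "stage_affine S r G"
  shows "stage_affine S r (\<lambda>\<zeta>. F \<zeta> - G \<zeta>)"
  using assms unfolding stage_affine_def by (auto simp: algebra_simps)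

text \<open>Each stage occurs in at most one factor of the weight. If \<open>r\<close> lies in the
  window, that factor is affine and the others are constant; otherwise the whole weight is constant
  and \<open>a + b = 1\<close> gives the identity.\<close>

lemma stage_affine_wt:
  assumes valid: "valid_setting S" and r: "r \<in> {1..N_of S}" and \<kappa>: "\<kappa> \<in> Idx S \<tau>"
  shows "stage_affine S r (wt S \<tau> \<kappa>)"
  unfolding stage_affine_def
proof (intro allI impI)
  fix \<zeta> x y and a b :: real
  assume xy: "x \<in> Rn (nu S r - 1)" "y \<in> Rn (nu S r - 1)" and ab: "a + b = 1"
  let ?l = "\<lambda>\<zeta> s. lam S (\<tau> - mu_of S + s) (\<kappa> s) (\<zeta> (\<tau> - mu_of S + s))"
  \<comment> \<open>The position of stage \<open>r\<close> in the window ending at \<tau>; it may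
    fall outside the window.\<close>
  define p where "p = r - \<tau> + mu_of S"
  have same: "?l (\<zeta>(r := z)) s = ?l \<zeta> s" if "s \<noteq> p" for z s
    using that by (simp add: p_def)
  show "wt S \<tau> \<kappa> (\<zeta>(r := a *\<^sub>R x + b *\<^sub>R y)) =
    a * wt S \<tau> \<kappa> (\<zeta>(r := x)) + b * wt S \<tau> \<kappa> (\<zeta>(r := y))"
  proof (cases "p \<in> {1..mu_of S}")
    case True
    have wt_eq: "wt S \<tau> \<kappa> (\<zeta>(r := z)) = lam S r (\<kappa> p) z * prod (?l \<zeta>) ({1..mu_of S} - {p})" for z
    proof -
      have "wt S \<tau> \<kappa> (\<zeta>(r := z)) =
        ?l (\<zeta>(r := z)) p * prod (?l (\<zeta>(r := z))) ({1..mu_of S} - {p})"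
        unfolding wt_def by (rule prod.remove) (use True in auto)
      also have "prod (?l (\<zeta>(r := z))) ({1..mu_of S} - {p}) = prod (?l \<zeta>) ({1..mu_of S} - {p})"
        by (rule prod.cong) (use same in auto)
      also have "?l (\<zeta>(r := z)) p = lam S r (\<kappa> p) z"
        by (simp add: p_def)
      finally show ?thesis .
    qed
    have "\<kappa> p \<in> {1..nu S r}"
      using \<kappa> True PiE_mem[of \<kappa> "{1..mu_of S}" _ p] by (force simp: Idx_def p_def)
    then show ?thesis
      using lam_affine[OF valid r xy ab] by (simp add: wt_eq algebra_simps)
  next
    case False
    have "wt S \<tau> \<kappa> (\<zeta>(r := z)) = wt S \<tau> \<kappa> \<zeta>" for z
      using False unfolding wt_def by (intro prod.cong refl same) auto
    then show ?thesis
      using ab by (simp flip: distrib_right)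
  qed
qed

lemma chi_in_Rn:
  assumes "valid_setting S" "t \<in> {1..N_of S}" "k \<in> {1..nscen S t}"
  shows "chi S t k \<in> Rn (nu S t - 1)"
  using valid_basis(4)[OF assms(1,2)] hull_subset[of "chi S t ` {1..nscen S t}" affine] assms(3)
  by blast

text \<open>The product form matches that of \<open>trajectories\<close>, so that scenario sets can
  be exchanged for their hulls one factor at a time.\<close>

lemma scenario_trajectories_eq:
  "scenario_trajectories S = (\<Pi>\<^sub>E t\<in>{1..N_of S}. chi S t ` {1..nscen S t})"
proof (intro set_eqI iffI)
  fix \<zeta> assume "\<zeta> \<in> scenario_trajectories S"
  then show "\<zeta> \<in> (\<Pi>\<^sub>E t\<in>{1..N_of S}. chi S t ` {1..nscen S t})"
    by (fastforce simp: scenario_trajectories_def scen_def Dset_def PiE_iff)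
next
  fix \<zeta> assume \<zeta>: "\<zeta> \<in> (\<Pi>\<^sub>E t\<in>{1..N_of S}. chi S t ` {1..nscen S t})"
  then have "\<forall>t\<in>{1..N_of S}. \<exists>k\<in>{1..nscen S t}. \<zeta> t = chi S t k"
    by (fastforce simp: PiE_iff)
  then obtain \<xi> where \<xi>: "\<And>t. t \<in> {1..N_of S} \<Longrightarrow> \<xi> t \<in> {1..nscen S t} \<and> \<zeta> t = chi S t (\<xi> t)"
    by metis
  have "restrict \<xi> {1..N_of S} \<in> Dset S 1 (N_of S)"
    using \<xi> by (auto simp: Dset_def)
  moreover have "\<zeta> = restrict (scen S (restrict \<xi> {1..N_of S})) {1..N_of S}"
    by (rule extensionalityI[of _ "{1..N_of S}"]) (use \<zeta> \<xi> in \<open>auto simp: scen_def PiE_iff\<close>)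
  ultimately show "\<zeta> \<in> scenario_trajectories S"
    by (auto simp: scenario_trajectories_def)
qed

lemma scenario_trajectories_subset: "scenario_trajectories S \<subseteq> trajectories S"
  unfolding scenario_trajectories_eq trajectories_def Delta_def
  by (rule PiE_mono) (rule hull_subset)

text \<open>Induction over the set \<open>A\<close> of stages already relaxed from scenario points
  to the full polytope; the induction hypothesis gives the bound at each scenario of the newly
  relaxed stage.\<close>

lemma stage_affine_le_0_on_hulls:
  assumes valid: "valid_setting S" and G: "\<And>r. r \<in> {1..N_of S} \<Longrightarrow> stage_affine S r G"
    and vertices: "\<And>\<zeta>. \<zeta> \<in> scenario_trajectories S \<Longrightarrow> G \<zeta> \<le> 0"
    and \<zeta>: "\<zeta> \<in> trajectories S"
  shows "G \<zeta> \<le> 0"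
proof -
  define T where
    "T = (\<lambda>A. \<Pi>\<^sub>E t\<in>{1..N_of S}. if t \<in> A then Delta S t else chi S t ` {1..nscen S t})"
  have "G \<zeta> \<le> 0" if "finite A" "A \<subseteq> {1..N_of S}" "\<zeta> \<in> T A" for A \<zeta>
    using that
  proof (induction A arbitrary: \<zeta> rule: finite_induct)
    case empty
    then show ?case
      using vertices by (simp add: T_def scenario_trajectories_eq)
  next
    case (insert r A)
    then have r: "r \<in> {1..N_of S}" by simp
    \<comment> \<open>The points that can be inserted at stage \<open>r\<close> without violating
      the bound. Affinity makes this set convex, and it contains the scenarios, hence their
      hull.\<close>
    define H where "H = {x \<in> Rn (nu S r - 1). G (\<zeta>(r := x)) \<le> 0}"
    have "chi S r k \<in> H" if k: "k \<in> {1..nscen S r}" for k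
    proof -
      have "\<zeta>(r := chi S r k) \<in> T A"
        using insert.prems(2) insert.hyps(2) r k by (auto simp: T_def PiE_iff extensional_def)
      then show ?thesis
        using insert.IH insert.prems(1) chi_in_Rn[OF valid r k] by (simp add: H_def)
    qed
    moreover have "convex H"
    proof (rule convexI)
      fix x y and a b :: real
      assume xy: "x \<in> H" "y \<in> H" and ab: "0 \<le> a" "0 \<le> b" "a + b = 1"
      have "G (\<zeta>(r := a *\<^sub>R x + b *\<^sub>R y)) = a * G (\<zeta>(r := x)) + b * G (\<zeta>(r := y))"
        using G[OF r] xy ab(3) by (simp add: stage_affine_def H_def)
      also have "\<dots> \<le> 0"
        using xy ab by (simp add: H_def add_nonpos_nonpos mult_nonneg_nonpos)
      finally show "a *\<^sub>R x + b *\<^sub>R y \<in> H"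
        using affine_Rn[OF valid r] xy ab(3) by (simp add: H_def)
    qed
    ultimately have "Delta S r \<subseteq> H"
      unfolding Delta_def by (intro hull_minimal) auto
    moreover have "\<zeta> r \<in> Delta S r"
      using insert.prems(2) r by (simp add: T_def PiE_iff) (metis atLeastAtMost_iff)
    \<comment> \<open>Inserting \<open>\<zeta> r\<close> at its own place leaves \<zeta>
      unchanged.\<close>
    ultimately show ?case
      by (auto simp: H_def)
  qed
  moreover have "\<zeta> \<in> T {1..N_of S}"
    using \<zeta> by (simp add: T_def trajectories_def PiE_iff)
  ultimately show ?thesis
    by blast
qed

text \<open>\<open>u_val\<close> and \<open>y_val\<close> are the values that (a) and (b) force on \<open>u\<close> and \<open>y\<close>, evaluated along an
  arbitrary trajectory.\<close>

definition u_val :: "setting \<Rightarrow> (svar \<Rightarrow>\<^sub>0 real) \<Rightarrow> int \<Rightarrow> int \<Rightarrow> trajectory \<Rightarrow> nat \<Rightarrow> real" where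
  "u_val S v t \<tau> \<zeta> i = (\<Sum>\<kappa>\<in>Idx S \<tau>. wt S \<tau> \<kappa> \<zeta> * Poly_Mapping.lookup v (V t \<tau> \<kappa> i))"

definition y_val :: "setting \<Rightarrow> (svar \<Rightarrow>\<^sub>0 real) \<Rightarrow> int \<Rightarrow> int \<Rightarrow> trajectory \<Rightarrow> nat \<Rightarrow> real" where
  "y_val S v t s \<zeta> i = (\<Sum>\<tau>=s..t. \<Sum>j<xdim S \<tau>. Amat S t \<tau> i j * u_val S v \<tau> s \<zeta> j)
     - (\<Sum>\<kappa>\<in>Idx S s. wt S s \<kappa> \<zeta> * bcoef S t s \<kappa> i)"

lemma stage_affine_y_val:
  assumes "valid_setting S" "r \<in> {1..N_of S}"
  shows "stage_affine S r (\<lambda>\<zeta>. y_val S v t s \<zeta> i)"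
proof -
  have wt: "stage_affine S r (\<lambda>\<zeta>. \<Sum>\<kappa>\<in>Idx S \<tau>. wt S \<tau> \<kappa> \<zeta> * c \<kappa>)" for \<tau> c
    using stage_affine_cmult[OF stage_affine_wt[OF assms]]
    by (intro stage_affine_sum) (simp add: mult.commute)
  show ?thesis
    unfolding y_val_def u_val_def
    by (intro stage_affine_diff stage_affine_sum stage_affine_cmult wt)
qed

text \<open>Exchanging sums over the triangle \<open>1 \<le> s \<le> \<tau> \<le> t\<close> regroups
  the contributions by the stage \<open>s\<close> at which a memory window ends, instead of by the
  decision stage \<tau>.\<close>

lemma excess_eq_sum_y_val:
  "(\<Sum>\<tau>=1..t. \<Sum>j<xdim S \<tau>. Amat S t \<tau> i j * decision S v \<tau> \<zeta> j) - rhs S t \<zeta> i =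
   (\<Sum>s=1..t. y_val S v t s \<zeta> i)"
proof -
  let ?a = "\<lambda>\<tau> s. \<Sum>j<xdim S \<tau>. Amat S t \<tau> i j * u_val S v \<tau> s \<zeta> j"
  have "(\<Sum>\<tau>=1..t. \<Sum>j<xdim S \<tau>. Amat S t \<tau> i j * decision S v \<tau> \<zeta> j) =
    (\<Sum>\<tau>=1..t. \<Sum>j<xdim S \<tau>. \<Sum>s=1..\<tau>. Amat S t \<tau> i j * u_val S v \<tau> s \<zeta> j)"
    by (simp add: decision_def u_val_def sum_distrib_left)
  also have "\<dots> = (\<Sum>\<tau>=1..t. \<Sum>s=1..\<tau>. ?a \<tau> s)"
    by (intro sum.cong refl sum.swap)
  also have "\<dots> = (\<Sum>\<tau>=1..t. \<Sum>s\<in>{s\<in>{1..t}. s \<le> \<tau>}. ?a \<tau> s)"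
    by (intro sum.cong refl) auto
  also have "\<dots> = (\<Sum>s=1..t. \<Sum>\<tau>\<in>{\<tau>\<in>{1..t}. s \<le> \<tau>}. ?a \<tau> s)"
    by (rule sum.swap_restrict) auto
  also have "\<dots> = (\<Sum>s=1..t. \<Sum>\<tau>=s..t. ?a \<tau> s)"
    by (intro sum.cong refl) auto
  finally show ?thesis
    by (simp add: y_val_def rhs_def sum_subtractf)
qed

lemma satisfies_on_iff_y_val:
  "satisfies_on S v T \<longleftrightarrow>
     (\<forall>t\<in>{1..N_of S}. \<forall>\<zeta>\<in>T. \<forall>i<cdim S t. (\<Sum>s=1..t. y_val S v t s \<zeta> i) \<le> 0)"
  unfolding satisfies_on_def by (simp flip: excess_eq_sum_y_val)

lemma satisfies_on_trajectories_iff_scenarios: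
  assumes "valid_setting S"
  shows "satisfies_on S v (trajectories S) \<longleftrightarrow> satisfies_on S v (scenario_trajectories S)"
proof
  show "satisfies_on S v (trajectories S) \<Longrightarrow> satisfies_on S v (scenario_trajectories S)"
    using scenario_trajectories_subset by (auto simp: satisfies_on_def)
  show "satisfies_on S v (trajectories S)" if "satisfies_on S v (scenario_trajectories S)"
    unfolding satisfies_on_iff_y_val
  proof (intro ballI allI impI)
    fix t \<zeta> i assume ti: "t \<in> {1..N_of S}" "i < cdim S t" and \<zeta>: "\<zeta> \<in> trajectories S"
    show "(\<Sum>s=1..t. y_val S v t s \<zeta> i) \<le> 0"
    proof (rule stage_affine_le_0_on_hulls[where G = "\<lambda>\<zeta>. \<Sum>s=1..t. y_val S v t s \<zeta> i",
          OF assms _ _ \<zeta>])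
      show "stage_affine S r (\<lambda>\<zeta>. \<Sum>s=1..t. y_val S v t s \<zeta> i)" if "r \<in> {1..N_of S}" for r
        by (rule stage_affine_sum, rule stage_affine_y_val[OF assms that])
      show "(\<Sum>s=1..t. y_val S v t s \<zeta>' i) \<le> 0" if "\<zeta>' \<in> scenario_trajectories S" for \<zeta>'
        using \<open>satisfies_on S v (scenario_trajectories S)\<close> that ti
        unfolding satisfies_on_iff_y_val by blast
    qed
  qed
qed

section \<open>Dynamic programming over scenario windows\<close>

text \<open>At nonpositive stages \<open>lam\<close> is constantly 1, so agreement on the positive
  part of the window is enough. Hence trajectories given on \<open>1..N\<close> alone suffice
  although windows reach further back.\<close>

lemma wt_cong:
  assumes "\<And>r. 1 \<le> r \<Longrightarrow> r \<in> {\<tau> - mu_of S + 1..\<tau>} \<Longrightarrow> \<zeta> r = \<zeta>' r"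
  shows "wt S \<tau> \<kappa> \<zeta> = wt S \<tau> \<kappa> \<zeta>'"
  unfolding wt_def
proof (rule prod.cong)
  fix s assume "s \<in> {1..mu_of S}"
  then show "lam S (\<tau> - mu_of S + s) (\<kappa> s) (\<zeta> (\<tau> - mu_of S + s)) =
    lam S (\<tau> - mu_of S + s) (\<kappa> s) (\<zeta>' (\<tau> - mu_of S + s))"
    using assms[of "\<tau> - mu_of S + s"] by (cases "\<tau> - mu_of S + s \<le> 0") (auto simp: lam_def)
qed simp

lemma y_val_cong:
  assumes "\<And>r. 1 \<le> r \<Longrightarrow> r \<in> {s - mu_of S + 1..s} \<Longrightarrow> \<zeta> r = \<zeta>' r"
  shows "y_val S v t s \<zeta> i = y_val S v t s \<zeta>' i"
proof -
  have "wt S s \<kappa> \<zeta> = wt S s \<kappa> \<zeta>'" for \<kappa>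
    using assms by (rule wt_cong)
  then show ?thesis
    by (simp add: y_val_def u_val_def)
qed

lemma finite_Dset: "finite (Dset S p q)"
  by (simp add: Dset_def finite_PiE)

lemma finite_Idx: "finite (Idx S \<tau>)"
  by (simp add: Idx_def finite_PiE)

lemma Dset_restrict:
  assumes "\<xi> \<in> Dset S p q" "p \<le> p'" "q' \<le> q"
  shows "restrict \<xi> {p'..q'} \<in> Dset S p' q'"
  using assms by (auto simp: Dset_def PiE_iff)

text \<open>Unprescribed stages get scenario 1, which exists at every stage up to the horizon,
  nonpositive ones included.\<close>

lemma Dset_extend:
  assumes "valid_setting S" "\<xi> \<in> Dset S p q" "q' \<le> N_of S"
  obtains \<xi>' where "\<xi>' \<in> Dset S p' q'" "\<And>s. s \<in> {p..q} \<inter> {p'..q'} \<Longrightarrow> \<xi>' s = \<xi> s"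
proof
  let ?e = "restrict (\<lambda>s. if s \<in> {p..q} then \<xi> s else 1) {p'..q'}"
  show "?e \<in> Dset S p' q'"
    using assms valid_nscen[OF assms(1)] by (auto simp: Dset_def PiE_iff)
qed auto

lemma restrict_eq_self: "\<xi> \<in> Dset S p q \<Longrightarrow> restrict \<xi> {p..q} = \<xi>"
  by (simp add: Dset_def PiE_iff extensional_restrict)

text \<open>The forward direction takes for \<open>z s \<eta>\<close> the maximal cost from stage \<open>s\<close> on among the index
  sequences extending \<open>\<eta>\<close>; the converse telescopes.\<close>

lemma cost_to_go_certificate:
  fixes Y :: "int \<Rightarrow> midx \<Rightarrow> real"
  assumes valid: "valid_setting S" and t: "1 \<le> t" "t \<le> N_of S"
  defines "\<mu> \<equiv> mu_of S"
  shows "(\<forall>\<xi>\<in>Dset S (2 - \<mu>) t. (\<Sum>s=1..t. Y s (restrict \<xi> {s - \<mu> + 1..s})) \<le> 0) \<longleftrightarrow>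
    (\<exists>z. (\<forall>\<eta>. z (t + 1) \<eta> = 0) \<and>
       (\<forall>s\<in>{1..t}. \<forall>\<xi>\<in>Dset S (s - \<mu> + 1) s.
          Y s \<xi> + z (s + 1) (restrict \<xi> {s - \<mu> + 2..s}) \<le> z s (restrict \<xi> {s - \<mu> + 1..s - 1})) \<and>
       (\<forall>\<eta>\<in>Dset S (2 - \<mu>) 0. z 1 \<eta> \<le> 0))"
    (is "?lhs \<longleftrightarrow> (\<exists>z. ?end z \<and> ?rec z \<and> ?start z)")
proof
  have \<mu>: "\<mu> \<ge> 1"
    using valid_memory[OF valid] by (simp add: \<mu>_def)
  {
    assume "\<exists>z. ?end z \<and> ?rec z \<and> ?start z"
    then obtain z where z: "?end z" "?rec z" "?start z" by blast
    show ?lhs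
    proof
      fix \<xi> assume \<xi>: "\<xi> \<in> Dset S (2 - \<mu>) t"
      \<comment> \<open>The values of \<open>z\<close> met along the fixed sequence \<xi>: each
        inequality bounds one stage cost by a drop of \<open>f\<close>.\<close>
      define f where "f = (\<lambda>s. z s (restrict \<xi> {s - \<mu> + 1..s - 1}))"
      have step: "Y s (restrict \<xi> {s - \<mu> + 1..s}) \<le> f s - f (s + 1)" if s: "s \<in> {1..t}" for s
      proof -
        have "restrict \<xi> {s - \<mu> + 1..s} \<in> Dset S (s - \<mu> + 1) s"
          using Dset_restrict[OF \<xi>] s by simp
        from z(2)[rule_format, OF s this] show ?thesis
          using \<mu> by (simp add: f_def Int_absorb1 algebra_simps Int_absorb2)
      qed
      have tel: "(\<Sum>s=1..int k. f s - f (s + 1)) = f 1 - f (int k + 1)" for k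
      proof (induction k)
        case (Suc k)
        have "{1..int (Suc k)} = insert (int (Suc k)) {1..int k}"
          by auto
        with Suc show ?case
          by (simp add: add.commute)
      qed simp
      have "(\<Sum>s=1..t. Y s (restrict \<xi> {s - \<mu> + 1..s})) \<le> (\<Sum>s=1..t. f s - f (s + 1))"
        by (rule sum_mono) (rule step)
      also have "\<dots> = f 1 - f (t + 1)"
        using tel[of "nat t"] t by simp
      also have "\<dots> \<le> 0"
        using z(1,3) Dset_restrict[OF \<xi>, of "2 - \<mu>" 0] t by (simp add: f_def)
      finally show "(\<Sum>s=1..t. Y s (restrict \<xi> {s - \<mu> + 1..s})) \<le> 0" .
    qed
  }
  assume lhs: ?lhs
  define E where
    "E = (\<lambda>s \<eta>. {\<xi> \<in> Dset S (s - \<mu> + 1) t. restrict \<xi> {s - \<mu> + 1..s - 1} = \<eta>})"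
  define g where "g = (\<lambda>s \<xi>. \<Sum>r=s..t. Y r (restrict \<xi> {r - \<mu> + 1..r}))"
  \<comment> \<open>For \<eta> in the index set a continuation exists, as \<open>attained\<close>
    shows. The default 0 elsewhere makes the end condition hold for every argument.\<close>
  define z where "z = (\<lambda>s \<eta>. if E s \<eta> = {} then 0 else Max (g s ` E s \<eta>))"
  have fin: "finite (E s \<eta>)" for s \<eta>
    by (simp add: E_def finite_Dset)
  have attained: "\<exists>\<xi>\<in>E s \<eta>. z s \<eta> = g s \<xi>"
    if \<eta>: "\<eta> \<in> Dset S (s - \<mu> + 1) (s - 1)" and "s \<le> t + 1" for s \<eta>
  proof -
    obtain \<xi> where \<xi>: "\<xi> \<in> Dset S (s - \<mu> + 1) t"
      "\<And>r. r \<in> {s - \<mu> + 1..s - 1} \<inter> {s - \<mu> + 1..t} \<Longrightarrow> \<xi> r = \<eta> r"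
      using Dset_extend[OF valid \<eta> t(2)] by blast
    have "restrict \<xi> {s - \<mu> + 1..s - 1} = restrict \<eta> {s - \<mu> + 1..s - 1}"
      using \<xi>(2) that(2) by (intro restrict_ext) auto
    then have ne: "E s \<eta> \<noteq> {}"
      using \<xi>(1) restrict_eq_self[OF that(1)] by (auto simp: E_def)
    then have "Max (g s ` E s \<eta>) \<in> g s ` E s \<eta>"
      by (intro Max_in) (auto simp: fin)
    then show ?thesis
      using ne by (auto simp: z_def)
  qed
  have le: "g s \<xi> \<le> z s \<eta>" if "\<xi> \<in> E s \<eta>" for s \<eta> \<xi>
    using that fin by (auto simp: z_def intro!: Max_ge)
  have "?end z"
  proof
    fix \<eta>
    have "g (t + 1) ` E (t + 1) \<eta> = {0}" if "E (t + 1) \<eta> \<noteq> {}"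
      using that by (auto simp: g_def)
    then show "z (t + 1) \<eta> = 0"
      by (auto simp: z_def)
  qed
  moreover have "?rec z"
  proof (intro ballI)
    fix s \<xi> assume s: "s \<in> {1..t}" and \<xi>: "\<xi> \<in> Dset S (s - \<mu> + 1) s"
    have "restrict \<xi> {s - \<mu> + 2..s} \<in> Dset S (s + 1 - \<mu> + 1) (s + 1 - 1)"
      using Dset_restrict[OF \<xi>, of "s - \<mu> + 2" s] by (simp add: algebra_simps)
    from attained[OF this] s obtain \<xi>' where
      \<xi>': "\<xi>' \<in> E (s + 1) (restrict \<xi> {s - \<mu> + 2..s})"
        "z (s + 1) (restrict \<xi> {s - \<mu> + 2..s}) = g (s + 1) \<xi>'"
      by auto
    have D: "\<xi>' \<in> Dset S (s - \<mu> + 2) t"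
      and R: "restrict \<xi>' {s - \<mu> + 2..s} = restrict \<xi> {s - \<mu> + 2..s}"
      using \<xi>'(1) by (simp_all add: E_def algebra_simps)
    have agree: "\<xi>' r = \<xi> r" if "r \<in> {s - \<mu> + 2..s}" for r
      using fun_cong[OF R, of r] that by simp
    \<comment> \<open>The optimal continuation \<xi>' starts only at \<open>s - \<mu> + 2\<close>;
      putting the oldest index of \<xi> in front makes it a competitor for the maximum at stage
      \<open>s\<close>.\<close>
    define \<xi>2 where "\<xi>2 = \<xi>'(s - \<mu> + 1 := \<xi> (s - \<mu> + 1))"
    have ag: "\<xi>2 r = \<xi> r" if "r \<in> {s - \<mu> + 1..s}" for r
      using agree[of r] that by (auto simp: \<xi>2_def)
    have "\<xi>2 r \<in> {1..nscen S r}" if "r \<in> {s - \<mu> + 1..t}" for r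
      using D \<xi> that \<mu> by (cases "r = s - \<mu> + 1") (auto simp: \<xi>2_def Dset_def PiE_iff)
    moreover have "\<xi>2 r = undefined" if "r \<notin> {s - \<mu> + 1..t}" for r
      using D s that \<mu> by (auto simp: \<xi>2_def Dset_def PiE_iff extensional_def)
    ultimately have "\<xi>2 \<in> E s (restrict \<xi> {s - \<mu> + 1..s - 1})"
      using ag by (auto simp: E_def Dset_def intro!: restrict_ext)
    then have "g s \<xi>2 \<le> z s (restrict \<xi> {s - \<mu> + 1..s - 1})"
      by (rule le)
    moreover have "g s \<xi>2 = Y s \<xi> + g (s + 1) \<xi>'"
    proof -
      have "{s..t} = insert s {s + 1..t}"
        using s by auto
      then have "g s \<xi>2 = Y s (restrict \<xi>2 {s - \<mu> + 1..s}) +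
        (\<Sum>r=s + 1..t. Y r (restrict \<xi>2 {r - \<mu> + 1..r}))"
        by (simp add: g_def)
      also have "restrict \<xi>2 {s - \<mu> + 1..s} = restrict \<xi> {s - \<mu> + 1..s}"
        using ag by (intro restrict_ext) auto
      also have "\<dots> = \<xi>"
        using \<xi> by (rule restrict_eq_self)
      \<comment> \<open>Windows ending after \<open>s\<close> begin after
        \<open>s - \<mu> + 1\<close>, so the later costs do not see the altered index.\<close>
      also have "(\<Sum>r=s + 1..t. Y r (restrict \<xi>2 {r - \<mu> + 1..r})) = g (s + 1) \<xi>'"
        unfolding g_def
        by (intro sum.cong refl arg_cong2[where f = Y] restrict_ext) (auto simp: \<xi>2_def)
      finally show ?thesis .
    qed
    ultimately show "Y s \<xi> + z (s + 1) (restrict \<xi> {s - \<mu> + 2..s}) \<le> z s (restrict \<xi> {s - \<mu> + 1..s - 1})"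
      using \<xi>'(2) by simp
  qed
  moreover have "?start z"
  proof
    fix \<eta> assume \<eta>: "\<eta> \<in> Dset S (2 - \<mu>) 0"
    then obtain \<xi> where "\<xi> \<in> E 1 \<eta>" "z 1 \<eta> = g 1 \<xi>"
      using attained[of \<eta> 1] t by auto
    then show "z 1 \<eta> \<le> 0"
      using lhs by (simp add: E_def g_def)
  qed
  ultimately show "\<exists>z. ?end z \<and> ?rec z \<and> ?start z"
    by blast
qed

text \<open>The index ranges \<open>1..N\<close> and \<open>2 - \<mu>..t\<close> are reconciled
  here. Stages after \<open>t\<close> do not enter the sum and nonpositive ones do not affect the
  weights, so sequences agreeing on \<open>1..t\<close> give the same value, and each can be
  extended to the other range.\<close>

lemma satisfies_on_scenarios_iff_windows:
  assumes valid: "valid_setting S"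
  shows "satisfies_on S v (scenario_trajectories S) \<longleftrightarrow>
    (\<forall>t\<in>{1..N_of S}. \<forall>i<cdim S t. \<forall>\<xi>\<in>Dset S (2 - mu_of S) t.
       (\<Sum>s=1..t. y_val S v t s (scen S (restrict \<xi> {s - mu_of S + 1..s})) i) \<le> 0)"
proof -
  have "(\<forall>\<zeta>\<in>scenario_trajectories S. (\<Sum>s=1..t. y_val S v t s \<zeta> i) \<le> 0) \<longleftrightarrow>
    (\<forall>\<xi>\<in>Dset S (2 - mu_of S) t.
       (\<Sum>s=1..t. y_val S v t s (scen S (restrict \<xi> {s - mu_of S + 1..s})) i) \<le> 0)"
    if t: "t \<in> {1..N_of S}" for t i
  proof -
    have eq: "(\<Sum>s=1..t. y_val S v t s (restrict (scen S \<xi>) {1..N_of S}) i) =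
      (\<Sum>s=1..t. y_val S v t s (scen S (restrict \<xi>' {s - mu_of S + 1..s})) i)"
      if "\<And>r. r \<in> {1..t} \<Longrightarrow> \<xi> r = \<xi>' r" for \<xi> \<xi>'
      using that t by (intro sum.cong refl y_val_cong) (auto simp: scen_def)
    show ?thesis
      unfolding scenario_trajectories_def
    proof (intro iffI ballI; clarsimp)
      fix \<xi>
      assume *: "\<forall>\<xi>\<in>Dset S 1 (N_of S).
          (\<Sum>s=1..t. y_val S v t s (restrict (scen S \<xi>) {1..N_of S}) i) \<le> 0"
        and \<xi>: "\<xi> \<in> Dset S (2 - mu_of S) t"
      obtain \<xi>' where "\<xi>' \<in> Dset S 1 (N_of S)"
        "\<And>r. r \<in> {2 - mu_of S..t} \<inter> {1..N_of S} \<Longrightarrow> \<xi>' r = \<xi> r"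
        using Dset_extend[OF valid \<xi> order_refl] by blast
      then show "(\<Sum>s=1..t. y_val S v t s (scen S (restrict \<xi> {s - mu_of S + 1..s})) i) \<le> 0"
        using * eq[of \<xi>' \<xi>] t valid_memory[OF valid] by (auto simp: Int_def)
    next
      fix \<xi>
      assume *: "\<forall>\<xi>\<in>Dset S (2 - mu_of S) t.
          (\<Sum>s=1..t. y_val S v t s (scen S (restrict \<xi> {s - mu_of S + 1..s})) i) \<le> 0"
        and \<xi>: "\<xi> \<in> Dset S 1 (N_of S)"
      obtain \<xi>' where "\<xi>' \<in> Dset S (2 - mu_of S) t"
        "\<And>r. r \<in> {1..N_of S} \<inter> {2 - mu_of S..t} \<Longrightarrow> \<xi>' r = \<xi> r"
        using Dset_extend[OF valid \<xi>, of t] t by (metis atLeastAtMost_iff)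
      then show "(\<Sum>s=1..t. y_val S v t s (restrict (scen S \<xi>) {1..N_of S}) i) \<le> 0"
        using * eq[of \<xi> \<xi>'] t valid_memory[OF valid] by (auto simp: Int_def)
    qed
  qed
  then show ?thesis
    unfolding satisfies_on_iff_y_val by blast
qed

section \<open>Size of the system\<close>

text \<open>There are at most \<open>N\<^sup>2\<close> pairs of stages, each with at most
  \<open>K * M\<close> members. Containment instead of equality admits families with a narrower
  range or a missing index, for which \<open>c\<close> ignores an argument.\<close>

lemma card_indexed_family:
  fixes c :: "int \<Rightarrow> int \<Rightarrow> 'x \<Rightarrow> nat \<Rightarrow> 'b"
  assumes A: "A \<subseteq> {c t \<tau> \<xi> i | t \<tau> \<xi> i. 1 \<le> \<tau> \<and> \<tau> \<le> t \<and> t \<le> int N \<and> \<xi> \<in> X t \<tau> \<and> i < k t}"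
    and X: "\<And>t \<tau>. 1 \<le> \<tau> \<Longrightarrow> \<tau> \<le> t \<Longrightarrow> t \<le> int N \<Longrightarrow> finite (X t \<tau>) \<and> card (X t \<tau>) \<le> K"
    and k: "\<And>t. 1 \<le> t \<Longrightarrow> t \<le> int N \<Longrightarrow> k t \<le> M"
  shows "finite A \<and> card A \<le> N\<^sup>2 * (K * M)"
proof -
  define J where "J = {p \<in> {1..int N} \<times> {1..int N}. snd p \<le> fst p}"
  define F where "F = (\<lambda>(t, \<tau>). (\<lambda>(\<xi>, i). c t \<tau> \<xi> i) ` (X t \<tau> \<times> {..<k t}))"
  have J: "finite J" "card J \<le> N\<^sup>2"
  proof -
    have "card J \<le> card ({1..int N} \<times> {1..int N})"
      by (rule card_mono) (auto simp: J_def)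
    then show "card J \<le> N\<^sup>2"
      by (simp add: card_cartesian_product power2_eq_square)
  qed (simp add: J_def)
  have F: "finite (F p) \<and> card (F p) \<le> K * M" if p_in: "p \<in> J" for p
  proof -
    obtain t \<tau> where p: "p = (t, \<tau>)" "1 \<le> \<tau>" "\<tau> \<le> t" "t \<le> int N"
      using p_in by (cases p) (auto simp: J_def)
    have "card (F p) \<le> card (X t \<tau> \<times> {..<k t})"
      unfolding p F_def prod.case using X[OF p(2-4)] by (intro card_image_le) simp
    also have "\<dots> \<le> K * M"
      using X[OF p(2-4)] k[of t] p by (simp add: card_cartesian_product mult_le_mono)
    finally show ?thesis
      using X[OF p(2-4)] by (simp add: p F_def)
  qed
  have sub: "A \<subseteq> \<Union> (F ` J)"
  proof
    fix a assume "a \<in> A"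
    with A obtain t \<tau> \<xi> i where a: "a = c t \<tau> \<xi> i" "1 \<le> \<tau>" "\<tau> \<le> t" "t \<le> int N" "\<xi> \<in> X t \<tau>" "i < k t"
      by auto
    then have "(t, \<tau>) \<in> J" "a \<in> F (t, \<tau>)"
      by (auto simp: J_def F_def)
    then show "a \<in> \<Union> (F ` J)"
      by blast
  qed
  have fin: "finite (\<Union> (F ` J))"
    using J F by blast
  have "card A \<le> card (\<Union> (F ` J))"
    by (rule card_mono[OF fin sub])
  also have "\<dots> \<le> (\<Sum>p\<in>J. card (F p))"
    by (rule card_UN_le[OF J(1)])
  also have "\<dots> \<le> card J * (K * M)"
    using sum_bounded_above[of J "\<lambda>p. card (F p)" "K * M"] F by simp
  also have "\<dots> \<le> N\<^sup>2 * (K * M)"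
    using J(2) by (rule mult_le_mono1)
  finally show ?thesis
    using finite_subset[OF sub fin] by blast
qed

lemma card_system:
  assumes valid: "valid_setting S"
    and bd: "\<And>t. t \<in> {1..N_of S} \<Longrightarrow> nscen S t \<le> d \<and> cdim S t \<le> m \<and> xdim S t \<le> n"
  defines "B \<equiv> (horizon S)\<^sup>2 * d ^ memory S"
  shows "finite (svars S) \<and> card (svars S) \<le> 4 * ((m + n) * B) \<and>
    finite (labels S) \<and> card (labels S) \<le> 4 * ((m + n) * B)"
proof -
  \<comment> \<open>Stage 1 exists and has a scenario. Positivity of \<open>d\<close> covers
    nonpositive stages, windows shorter than \<mu> and the dummy index set below.\<close>
  have d1: "d \<ge> 1"
    using valid_horizon[OF valid] valid_nscen[OF valid, of 1] bd[of 1] by simp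
  have nscen: "nscen S t \<le> d" if "t \<le> N_of S" for t
    using bd[of t] valid_nonpos[OF valid, of t] d1 that by (cases "t \<ge> 1") auto
  have Idx: "finite (Idx S \<tau>) \<and> card (Idx S \<tau>) \<le> d ^ memory S" if "\<tau> \<le> N_of S" for \<tau>
  proof -
    have "card (Idx S \<tau>) = (\<Prod>s\<in>{1..mu_of S}. nu S (\<tau> - mu_of S + s))"
      by (simp add: Idx_def card_PiE)
    also have "\<dots> \<le> (\<Prod>s\<in>{1..mu_of S}. d)"
    proof (rule prod_mono)
      fix s assume "s \<in> {1..mu_of S}"
      then have "\<tau> - mu_of S + s \<le> N_of S"
        using that by simp
      then show "0 \<le> nu S (\<tau> - mu_of S + s) \<and> nu S (\<tau> - mu_of S + s) \<le> d"
        using nu_le_nscen[OF valid] nscen le_trans by blast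
    qed
    also have "\<dots> = d ^ memory S"
      by simp
    finally show ?thesis
      by (simp add: finite_Idx)
  qed
  have D: "finite (Dset S p q) \<and> card (Dset S p q) \<le> d ^ memory S"
    if "q \<le> N_of S" "q - p + 1 \<le> mu_of S" for p q
  proof -
    have "card (Dset S p q) = (\<Prod>s\<in>{p..q}. nscen S s)"
      by (simp add: Dset_def card_PiE)
    also have "\<dots> \<le> (\<Prod>s\<in>{p..q}. d)"
      using nscen that by (intro prod_mono) auto
    also have "\<dots> = d ^ nat (q - p + 1)"
      by (simp add: algebra_simps)
    also have "\<dots> \<le> d ^ memory S"
      using d1 that by (intro power_increasing) auto
    finally show ?thesis
      by (simp add: finite_Dset)
  qed
  have one: "card {()} \<le> d ^ memory S"
    using d1 by simp
  have m: "\<And>t. 1 \<le> t \<Longrightarrow> t \<le> N_of S \<Longrightarrow> cdim S t \<le> m"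
    and n: "\<And>t. 1 \<le> t \<Longrightarrow> t \<le> N_of S \<Longrightarrow> xdim S t \<le> n"
    using bd by auto
  have vvars: "finite (vvars S) \<and> card (vvars S) \<le> (horizon S)\<^sup>2 * (d ^ memory S * n)"
    unfolding vvars_def
    by (rule card_indexed_family[where c = V and X = "\<lambda>t. Idx S"])
      (use Idx in \<open>auto intro: n\<close>)
  have uvars: "finite (uvars S) \<and> card (uvars S) \<le> (horizon S)\<^sup>2 * (d ^ memory S * n)"
    unfolding uvars_def
    by (rule card_indexed_family[where c = U and X = "\<lambda>t \<tau>. Dset S (\<tau> - mu_of S + 1) \<tau>"])
      (use D in \<open>auto intro: n\<close>)
  have yvars: "finite (yvars S) \<and> card (yvars S) \<le> (horizon S)\<^sup>2 * (d ^ memory S * m)"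
    unfolding yvars_def
    by (rule card_indexed_family[where c = Y and X = "\<lambda>t s. Dset S (s - mu_of S + 1) s"])
      (use D in \<open>auto intro: m\<close>)
  have zvars: "finite (zvars S) \<and> card (zvars S) \<le> (horizon S)\<^sup>2 * (d ^ memory S * m)"
  proof (cases "memory S = 1")
    case True
    \<comment> \<open>For \<mu> = 1 the \<open>z\<close>-variables carry no scenario index; a
      one-element set takes its place.\<close>
    show ?thesis
      unfolding zvars_def if_P[OF True]
      by (rule card_indexed_family[where c = "\<lambda>t s _. Z1 t s" and X = "\<lambda>_ _. {()}"])
        (use one in \<open>auto intro: m\<close>)
  next
    case False
    show ?thesis
      unfolding zvars_def if_not_P[OF False]
      by (rule card_indexed_family[where c = Z and X = "\<lambda>t s. Dset S (s - mu_of S + 1) (s - 1)"])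
        (use D in \<open>auto intro: m\<close>)
  qed
  have svars: "finite (svars S)"
    using vvars uvars yvars zvars by (simp add: svars_def)
  have "card (svars S) \<le> card (vvars S) + card (uvars S) + card (yvars S) + card (zvars S)"
    unfolding svars_def
    by (meson add_le_mono1 card_Un_le order_trans)
  then have card_svars: "card (svars S) \<le> 4 * ((m + n) * B)"
    using vvars uvars yvars zvars by (simp add: B_def algebra_simps)
  let ?Lu = "{Def_u t \<tau> \<xi> i | t \<tau> \<xi> i.
    1 \<le> \<tau> \<and> \<tau> \<le> t \<and> t \<le> N_of S \<and> \<xi> \<in> Dset S (\<tau> - mu_of S + 1) \<tau> \<and> i < xdim S t}"
  let ?Ly = "{Def_y t s \<xi> i | t s \<xi> i.
    1 \<le> s \<and> s \<le> t \<and> t \<le> N_of S \<and> \<xi> \<in> Dset S (s - mu_of S + 1) s \<and> i < cdim S t}"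
  have Lu: "finite ?Lu \<and> card ?Lu \<le> (horizon S)\<^sup>2 * (d ^ memory S * n)"
    by (rule card_indexed_family[where c = Def_u and X = "\<lambda>t \<tau>. Dset S (\<tau> - mu_of S + 1) \<tau>"])
      (use D in \<open>auto intro: n\<close>)
  have Ly: "finite ?Ly \<and> card ?Ly \<le> (horizon S)\<^sup>2 * (d ^ memory S * m)"
    by (rule card_indexed_family[where c = Def_y and X = "\<lambda>t s. Dset S (s - mu_of S + 1) s"])
      (use D in \<open>auto intro: m\<close>)
  have "finite (labels S) \<and> card (labels S) \<le> 4 * ((m + n) * B)"
  proof (cases "memory S = 1")
    case True
    let ?L1 = "{Rec1 t s \<xi> i | t s \<xi> i.
      1 \<le> s \<and> s \<le> t \<and> t \<le> N_of S \<and> \<xi> \<in> Dset S s s \<and> i < cdim S t}"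
    let ?L2 = "{End1 t i | t i. 1 \<le> t \<and> t \<le> N_of S \<and> i < cdim S t}"
    have L1: "finite ?L1 \<and> card ?L1 \<le> (horizon S)\<^sup>2 * (d ^ memory S * m)"
      by (rule card_indexed_family[where c = Rec1 and X = "\<lambda>t s. Dset S s s"])
        (use D True in \<open>auto intro: m\<close>)
    have L2: "finite ?L2 \<and> card ?L2 \<le> (horizon S)\<^sup>2 * (d ^ memory S * m)"
      by (rule card_indexed_family[where c = "\<lambda>t s _. End1 t" and X = "\<lambda>_ _. {()}"])
        (use one in \<open>auto intro: m\<close>)
    have eq: "labels S = ?Lu \<union> ?Ly \<union> (?L1 \<union> ?L2)"
      unfolding labels_def if_P[OF True] ..
    have "card (labels S) \<le> card ?Lu + card ?Ly + (card ?L1 + card ?L2)"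
      unfolding eq by (meson add_le_mono card_Un_le order_trans)
    then have "card (labels S) \<le> 4 * ((m + n) * B)"
      using Lu Ly L1 L2 by (simp add: B_def algebra_simps)
    then show ?thesis
      unfolding eq using Lu Ly L1 L2 by blast
  next
    case False
    let ?L1 = "{Last t \<xi> i | t \<xi> i.
      1 \<le> t \<and> t \<le> N_of S \<and> \<xi> \<in> Dset S (t - mu_of S + 1) t \<and> i < cdim S t}"
    let ?L2 = "{Rec t s \<xi> i | t s \<xi> i.
      1 \<le> s \<and> s \<le> t - 1 \<and> t \<le> N_of S \<and> \<xi> \<in> Dset S (s - mu_of S + 1) s \<and> i < cdim S t}"
    let ?L3 = "{End t \<eta> i | t \<eta> i.
      1 \<le> t \<and> t \<le> N_of S \<and> \<eta> \<in> Dset S (2 - mu_of S) 0 \<and> i < cdim S t}"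
    \<comment> \<open>There is only one stage index here; a second one that is ignored fits the
      family into the count over pairs.\<close>
    have L1: "finite ?L1 \<and> card ?L1 \<le> (horizon S)\<^sup>2 * (d ^ memory S * m)"
      by (rule card_indexed_family[where c = "\<lambda>t s. Last t" and X = "\<lambda>t s. Dset S (t - mu_of S + 1) t"])
        (use D in \<open>auto intro: m\<close>)
    have L2: "finite ?L2 \<and> card ?L2 \<le> (horizon S)\<^sup>2 * (d ^ memory S * m)"
      by (rule card_indexed_family[where c = Rec and X = "\<lambda>t s. Dset S (s - mu_of S + 1) s"])
        (use D in \<open>fastforce intro: m\<close>)+
    have L3: "finite ?L3 \<and> card ?L3 \<le> (horizon S)\<^sup>2 * (d ^ memory S * m)"
      by (rule card_indexed_family[where c = "\<lambda>t s. End t" and X = "\<lambda>t s. Dset S (2 - mu_of S) 0"])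
        (use D in \<open>auto intro: m\<close>)
    have eq: "labels S = ?Lu \<union> ?Ly \<union> (?L1 \<union> ?L2 \<union> ?L3)"
      unfolding labels_def if_not_P[OF False] ..
    have "card (labels S) \<le> card ?Lu + card ?Ly + (card ?L1 + card ?L2 + card ?L3)"
      unfolding eq by (meson add_le_mono add_le_mono1 card_Un_le order_trans)
    \<comment> \<open>One family is bounded through \<open>n\<close> and four through
      \<open>m\<close>; the factor \<open>n + 4 * m\<close> is at most
      \<open>4 * (m + n)\<close>.\<close>
    then have "card (labels S) \<le> 4 * ((m + n) * B)"
      using Lu Ly L1 L2 L3 by (simp add: B_def algebra_simps)
    then show ?thesis
      unfolding eq using Lu Ly L1 L2 L3 by blast
  qed
  with svars card_svars show ?thesis
    by blast
qed

text \<open>Maxima over the finitely many stages serve as \<open>d\<close>, \<open>m\<close> and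
  \<open>n\<close> in the size bound, which also yields finiteness.\<close>

lemma finite_system:
  assumes "valid_setting S"
  shows "finite (svars S)" "finite (vvars S)"
proof -
  let ?Max = "\<lambda>f. Max (f ` {1..N_of S})"
  show "finite (svars S)"
    using card_system[OF assms, of "?Max (nscen S)" "?Max (cdim S)" "?Max (xdim S)"] by simp
  then show "finite (vvars S)"
    by (simp add: svars_def)
qed

section \<open>Feasibility of the system\<close>

text \<open>Both variants of the \<open>z\<close>-variables in one notation, with the convention \<open>z t (t + 1) = 0\<close>.\<close>

definition z_val :: "setting \<Rightarrow> (svar \<Rightarrow>\<^sub>0 real) \<Rightarrow> int \<Rightarrow> int \<Rightarrow> midx \<Rightarrow> nat \<Rightarrow> real" where
  "z_val S w t s \<eta> i =
     (if s > t then 0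
      else Poly_Mapping.lookup w (if memory S = 1 then Z1 t s i else Z t s \<eta> i))"

text \<open>Shaped like the condition in \<open>cost_to_go_certificate\<close>, so that (c) and (d)
  can be handled together.\<close>

definition z_system :: "setting \<Rightarrow> (svar \<Rightarrow>\<^sub>0 real) \<Rightarrow> bool" where
  "z_system S w \<longleftrightarrow>
     (\<forall>t\<in>{1..N_of S}. \<forall>i<cdim S t.
        (\<forall>s\<in>{1..t}. \<forall>\<xi>\<in>Dset S (s - mu_of S + 1) s.
           Poly_Mapping.lookup w (Y t s \<xi> i) + z_val S w t (s + 1) (restrict \<xi> {s - mu_of S + 2..s}) i
             \<le> z_val S w t s (restrict \<xi> {s - mu_of S + 1..s - 1}) i) \<and>
        (\<forall>\<eta>\<in>Dset S (2 - mu_of S) 0. z_val S w t 1 \<eta> i \<le> 0))"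

lemma Dset_empty_interval: "Dset S (s + 1) s = {\<lambda>_. undefined}"
  by (simp add: Dset_def)

text \<open>With memory 1 \<open>z_val\<close> ignores its multi-index, and its vanishing beyond
  \<open>t\<close> absorbs the case distinction at \<open>s = t\<close> in
  \<open>Rec1\<close>.\<close>

lemma z_system_iff_labels_1:
  assumes "memory S = 1"
  shows "z_system S w \<longleftrightarrow>
    (\<forall>t s \<xi> i. 1 \<le> s \<and> s \<le> t \<and> t \<le> N_of S \<and> \<xi> \<in> Dset S s s \<and> i < cdim S t \<longrightarrow>
       sat w (constr S (Rec1 t s \<xi> i))) \<and>
    (\<forall>t i. 1 \<le> t \<and> t \<le> N_of S \<and> i < cdim S t \<longrightarrow> sat w (constr S (End1 t i)))"
proof -
  have rec: "sat w (constr S (Rec1 t s \<xi> i)) \<longleftrightarrow>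
    Poly_Mapping.lookup w (Y t s \<xi> i) + z_val S w t (s + 1) \<eta> i \<le> z_val S w t s \<eta>' i"
    if "s \<le> t" for t s \<xi> i \<eta> \<eta>'
    using that assms by (auto simp: form_val_simps z_val_def)
  have start: "sat w (constr S (End1 t i)) \<longleftrightarrow> z_val S w t 1 \<eta> i \<le> 0" if "1 \<le> t" for t i \<eta>
    using that assms by (simp add: z_val_def)
  have "Dset S (2 - mu_of S) 0 = {\<lambda>_. undefined}"
    using Dset_empty_interval[of S 0] assms by simp
  then show ?thesis
    using assms by (auto simp: z_system_def simp del: sat.simps constr.simps
        simp flip: rec start[where \<eta> = "\<lambda>_. undefined"])
qed

text \<open>\<open>Last\<close> is the Bellman inequality at \<open>s = t\<close>, where the
  following \<open>z\<close> is zero; \<open>Rec\<close> covers the earlier stages.\<close>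

lemma z_system_iff_labels:
  assumes "memory S > 1"
  shows "z_system S w \<longleftrightarrow>
    (\<forall>t \<xi> i. 1 \<le> t \<and> t \<le> N_of S \<and> \<xi> \<in> Dset S (t - mu_of S + 1) t \<and> i < cdim S t \<longrightarrow>
       sat w (constr S (Last t \<xi> i))) \<and>
    (\<forall>t s \<xi> i. 1 \<le> s \<and> s \<le> t - 1 \<and> t \<le> N_of S \<and> \<xi> \<in> Dset S (s - mu_of S + 1) s \<and> i < cdim S t \<longrightarrow>
       sat w (constr S (Rec t s \<xi> i))) \<and>
    (\<forall>t \<eta> i. 1 \<le> t \<and> t \<le> N_of S \<and> \<eta> \<in> Dset S (2 - mu_of S) 0 \<and> i < cdim S t \<longrightarrow>
       sat w (constr S (End t \<eta> i)))"
    (is "_ \<longleftrightarrow> ?last \<and> ?rec \<and> ?start")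
proof -
  let ?step = "\<lambda>t s \<xi> i.
    Poly_Mapping.lookup w (Y t s \<xi> i) + z_val S w t (s + 1) (restrict \<xi> {s - mu_of S + 2..s}) i
      \<le> z_val S w t s (restrict \<xi> {s - mu_of S + 1..s - 1}) i"
  have last: "sat w (constr S (Last t \<xi> i)) \<longleftrightarrow> ?step t t \<xi> i" for t \<xi> i
    using assms by (auto simp: form_val_simps z_val_def)
  have rec: "sat w (constr S (Rec t s \<xi> i)) \<longleftrightarrow> ?step t s \<xi> i" if "s \<le> t - 1" for t s \<xi> i
    using assms that by (auto simp: form_val_simps z_val_def)
  have start: "sat w (constr S (End t \<eta> i)) \<longleftrightarrow> z_val S w t 1 \<eta> i \<le> 0" if "1 \<le> t" for t i \<eta>
    using that assms by (simp add: z_val_def)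
  have split: "(\<forall>s\<in>{1..t}. P s) \<longleftrightarrow> P t \<and> (\<forall>s. 1 \<le> s \<and> s \<le> t - 1 \<longrightarrow> P s)"
    if "1 \<le> t" for t :: int and P
    using that by (auto, metis dual_order.antisym zle_diff1_eq not_le)
  have "z_system S w \<longleftrightarrow>
    (\<forall>t\<in>{1..N_of S}. \<forall>i<cdim S t.
      ((\<forall>\<xi>\<in>Dset S (t - mu_of S + 1) t. ?step t t \<xi> i) \<and>
       (\<forall>s. 1 \<le> s \<and> s \<le> t - 1 \<longrightarrow> (\<forall>\<xi>\<in>Dset S (s - mu_of S + 1) s. ?step t s \<xi> i))) \<and>
      (\<forall>\<eta>\<in>Dset S (2 - mu_of S) 0. z_val S w t 1 \<eta> i \<le> 0))"
    unfolding z_system_def by (intro ball_cong refl) (simp only: split atLeastAtMost_iff)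
  also have "\<dots> \<longleftrightarrow> ?last \<and> ?rec \<and> ?start"
    by (simp only: last rec start cong: conj_cong imp_cong) (smt (verit) atLeastAtMost_iff last rec start)
  finally show ?thesis .
qed

text \<open>Eliminates the \<open>u\<close>-variables from (b): once the equations (a) hold, those
  for \<open>y\<close> can be stated with the values computed from the
  \<open>v\<close>-variables.\<close>

lemma feasible_iff:
  assumes valid: "valid_setting S"
  shows "feasible S w \<longleftrightarrow> w \<in> coord_space (svars S) \<and>
    (\<forall>t \<tau> \<xi> i. 1 \<le> \<tau> \<and> \<tau> \<le> t \<and> t \<le> N_of S \<and> \<xi> \<in> Dset S (\<tau> - mu_of S + 1) \<tau> \<and> i < xdim S t \<longrightarrow>
       Poly_Mapping.lookup w (U t \<tau> \<xi> i) = u_val S w t \<tau> (scen S \<xi>) i) \<and>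
    (\<forall>t s \<xi> i. 1 \<le> s \<and> s \<le> t \<and> t \<le> N_of S \<and> \<xi> \<in> Dset S (s - mu_of S + 1) s \<and> i < cdim S t \<longrightarrow>
       Poly_Mapping.lookup w (Y t s \<xi> i) = y_val S w t s (scen S \<xi>) i) \<and>
    z_system S w"
    (is "_ \<longleftrightarrow> _ \<and> ?U \<and> ?Y \<and> _")
proof -
  have u: "sat w (constr S (Def_u t \<tau> \<xi> i)) \<longleftrightarrow>
    Poly_Mapping.lookup w (U t \<tau> \<xi> i) = u_val S w t \<tau> (scen S \<xi>) i" for t \<tau> \<xi> i
    by (auto simp: form_val_simps u_val_def)
  have y: "sat w (constr S (Def_y t s \<xi> i)) \<longleftrightarrow>
    Poly_Mapping.lookup w (Y t s \<xi> i) = y_val S w t s (scen S \<xi>) i"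
    if "?U" "1 \<le> s" "s \<le> t" "t \<le> N_of S" "\<xi> \<in> Dset S (s - mu_of S + 1) s" for t s \<xi> i
  proof -
    have "(\<Sum>\<tau>=s..t. \<Sum>j<xdim S \<tau>. Amat S t \<tau> i j * Poly_Mapping.lookup w (U \<tau> s \<xi> j)) =
      (\<Sum>\<tau>=s..t. \<Sum>j<xdim S \<tau>. Amat S t \<tau> i j * u_val S w \<tau> s (scen S \<xi>) j)"
      using that by (intro sum.cong refl) auto
    then show ?thesis
      by (auto simp: form_val_simps y_val_def beta_def)
  qed
  have "(\<forall>l\<in>labels S. sat w (constr S l)) \<longleftrightarrow>
    (\<forall>t \<tau> \<xi> i. 1 \<le> \<tau> \<and> \<tau> \<le> t \<and> t \<le> N_of S \<and> \<xi> \<in> Dset S (\<tau> - mu_of S + 1) \<tau> \<and> i < xdim S t \<longrightarrow>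
       sat w (constr S (Def_u t \<tau> \<xi> i))) \<and>
    (\<forall>t s \<xi> i. 1 \<le> s \<and> s \<le> t \<and> t \<le> N_of S \<and> \<xi> \<in> Dset S (s - mu_of S + 1) s \<and> i < cdim S t \<longrightarrow>
       sat w (constr S (Def_y t s \<xi> i))) \<and> z_system S w"
  proof (cases "memory S = 1")
    case True
    show ?thesis
      unfolding z_system_iff_labels_1[OF True] labels_def if_P[OF True] ball_Un
      by (auto simp del: sat.simps constr.simps)
  next
    case False
    then have "memory S > 1"
      using valid_memory[OF valid] by simp
    then show ?thesis
      unfolding z_system_iff_labels[OF \<open>memory S > 1\<close>] labels_def if_not_P[OF False] ball_Un
      by (auto simp del: sat.simps constr.simps)
  qed
  then show ?thesis
    unfolding feasible_def u using y by blast
qed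

lemma u_val_cong:
  assumes "\<And>x. x \<in> vvars S \<Longrightarrow> Poly_Mapping.lookup w x = Poly_Mapping.lookup v x"
    and "1 \<le> \<tau>" "\<tau> \<le> t" "t \<le> N_of S" "i < xdim S t"
  shows "u_val S w t \<tau> \<zeta> i = u_val S v t \<tau> \<zeta> i"
  unfolding u_val_def
  by (intro sum.cong refl arg_cong2[where f = "(*)"] assms(1)) (use assms in \<open>auto simp: vvars_def\<close>)

lemma y_val_cong_vars:
  assumes "\<And>x. x \<in> vvars S \<Longrightarrow> Poly_Mapping.lookup w x = Poly_Mapping.lookup v x"
    and "1 \<le> s" "t \<le> N_of S"
  shows "y_val S w t s \<zeta> i = y_val S v t s \<zeta> i"
  unfolding y_val_def
  by (intro arg_cong2[where f = "(-)"] sum.cong refl arg_cong2[where f = "(*)"] u_val_cong assms(1))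
    (use assms in auto)

text \<open>Different pairs of stage \<open>t\<close> and row \<open>i\<close> share no
  \<open>z\<close>-variables, so the certificates can be chosen separately for each pair and
  assembled into one solution.\<close>

lemma satisfies_on_scenarios_iff_feasible:
  assumes valid: "valid_setting S"
  shows "satisfies_on S v (scenario_trajectories S) \<longleftrightarrow>
    (\<exists>w. feasible S w \<and> (\<forall>x\<in>vvars S. Poly_Mapping.lookup w x = Poly_Mapping.lookup v x))"
proof -
  let ?Y = "\<lambda>t i s \<xi>. y_val S v t s (scen S \<xi>) i"
  let ?cert = "\<lambda>t i z. (\<forall>\<eta>. z (t + 1) \<eta> = (0::real)) \<and>
    (\<forall>s\<in>{1..t}. \<forall>\<xi>\<in>Dset S (s - mu_of S + 1) s.
       ?Y t i s \<xi> + z (s + 1) (restrict \<xi> {s - mu_of S + 2..s})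
         \<le> z s (restrict \<xi> {s - mu_of S + 1..s - 1})) \<and>
    (\<forall>\<eta>\<in>Dset S (2 - mu_of S) 0. z 1 \<eta> \<le> 0)"
  have "satisfies_on S v (scenario_trajectories S) \<longleftrightarrow>
    (\<forall>t\<in>{1..N_of S}. \<forall>i<cdim S t. \<exists>z. ?cert t i z)"
    unfolding satisfies_on_scenarios_iff_windows[OF valid]
    by (intro ball_cong refl all_cong cost_to_go_certificate[OF valid]) auto
  also have "\<dots> \<longleftrightarrow>
    (\<exists>w. feasible S w \<and> (\<forall>x\<in>vvars S. Poly_Mapping.lookup w x = Poly_Mapping.lookup v x))"
  proof
    assume "\<exists>w. feasible S w \<and> (\<forall>x\<in>vvars S. Poly_Mapping.lookup w x = Poly_Mapping.lookup v x)"
    then obtain w where w: "feasible S w"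
      and wv: "\<And>x. x \<in> vvars S \<Longrightarrow> Poly_Mapping.lookup w x = Poly_Mapping.lookup v x"
      by blast
    show "\<forall>t\<in>{1..N_of S}. \<forall>i<cdim S t. \<exists>z. ?cert t i z"
    proof (intro ballI allI impI exI conjI)
      fix t i assume t: "t \<in> {1..N_of S}" and i: "i < cdim S t"
      let ?z = "\<lambda>s \<eta>. z_val S w t s \<eta> i"
      show "?z (t + 1) \<eta> = 0" for \<eta>
        by (simp add: z_val_def)
      show "?z 1 \<eta> \<le> 0" if "\<eta> \<in> Dset S (2 - mu_of S) 0" for \<eta>
        using w t i that unfolding feasible_iff[OF valid] z_system_def by blast
      show "?Y t i s \<xi> + ?z (s + 1) (restrict \<xi> {s - mu_of S + 2..s})
          \<le> ?z s (restrict \<xi> {s - mu_of S + 1..s - 1})"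
        if s: "s \<in> {1..t}" and \<xi>: "\<xi> \<in> Dset S (s - mu_of S + 1) s" for s \<xi>
      proof -
        have "Poly_Mapping.lookup w (Y t s \<xi> i) = y_val S w t s (scen S \<xi>) i"
          using w t i s \<xi> unfolding feasible_iff[OF valid] by simp
        also have "\<dots> = ?Y t i s \<xi>"
          using s t wv by (intro y_val_cong_vars) auto
        finally show ?thesis
          using w t i s \<xi> unfolding feasible_iff[OF valid] z_system_def by metis
      qed
    qed
  next
    assume "\<forall>t\<in>{1..N_of S}. \<forall>i<cdim S t. \<exists>z. ?cert t i z"
    then obtain z where z: "\<And>t i. t \<in> {1..N_of S} \<Longrightarrow> i < cdim S t \<Longrightarrow> ?cert t i (z t i)"
      by metis
    \<comment> \<open>The \<open>u\<close>- and \<open>y\<close>-values are forced by (a) and (b);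
      the \<open>z\<close>-values come from the certificates, evaluated at the sole multi-index,
      undefined everywhere, when \<mu> = 1.\<close>
    define h where "h = (\<lambda>x. case x of
        V t \<tau> \<kappa> i \<Rightarrow> Poly_Mapping.lookup v (V t \<tau> \<kappa> i)
      | U t \<tau> \<xi> i \<Rightarrow> u_val S v t \<tau> (scen S \<xi>) i
      | Y t s \<xi> i \<Rightarrow> y_val S v t s (scen S \<xi>) i
      | Z1 t s i \<Rightarrow> z t i s (\<lambda>_. undefined)
      | Z t s \<eta> i \<Rightarrow> z t i s \<eta>)"
    \<comment> \<open>Cutting off outside the finite set of variables makes the support
      finite.\<close>
    define w where "w = Poly_Mapping.Abs_poly_mapping (\<lambda>x. if x \<in> svars S then h x else 0)"
    have "finite {x. (if x \<in> svars S then h x else 0) \<noteq> 0}"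
      by (rule finite_subset[OF _ finite_system(1)[OF valid]]) auto
    then have w: "Poly_Mapping.lookup w = (\<lambda>x. if x \<in> svars S then h x else 0)"
      unfolding w_def by (rule lookup_Abs_poly_mapping)
    have wv: "Poly_Mapping.lookup w x = Poly_Mapping.lookup v x" if "x \<in> vvars S" for x
      using that by (auto simp: w h_def svars_def vvars_def)
    have y: "Poly_Mapping.lookup w (Y t s \<xi> i) = ?Y t i s \<xi>"
      if "1 \<le> s" "s \<le> t" "t \<le> N_of S" "\<xi> \<in> Dset S (s - mu_of S + 1) s" "i < cdim S t" for t s \<xi> i
      using that by (auto simp: w h_def svars_def yvars_def)
    have u: "Poly_Mapping.lookup w (U t \<tau> \<xi> i) = u_val S v t \<tau> (scen S \<xi>) i"
      if "1 \<le> \<tau>" "\<tau> \<le> t" "t \<le> N_of S" "\<xi> \<in> Dset S (\<tau> - mu_of S + 1) \<tau>" "i < xdim S t" for t \<tau> \<xi> i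
      using that by (auto simp: w h_def svars_def uvars_def)
    \<comment> \<open>At \<open>s = t + 1\<close> both sides vanish: the left by convention, the
      right by the end condition of the certificate.\<close>
    have zz: "z_val S w t s \<eta> i = z t i s \<eta>"
      if t: "t \<in> {1..N_of S}" and i: "i < cdim S t" and s: "1 \<le> s" "s \<le> t + 1"
        and \<eta>: "\<eta> \<in> Dset S (s - mu_of S + 1) (s - 1)" for t s i \<eta>
    proof (cases "s = t + 1")
      case True
      then show ?thesis
        using z[OF t i] by (simp add: z_val_def)
    next
      case False
      then have "(if memory S = 1 then Z1 t s i else Z t s \<eta> i) \<in> svars S"
        using t i s \<eta> by (auto simp: svars_def zvars_def)
      moreover have "\<eta> = (\<lambda>_. undefined)" if "memory S = 1"
        using \<eta> that Dset_empty_interval[of S "s - 1"] by simp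
      ultimately show ?thesis
        using False s by (auto simp: z_val_def w h_def)
    qed
    have "feasible S w"
      unfolding feasible_iff[OF valid]
    proof (intro conjI allI impI)
      show "w \<in> coord_space (svars S)"
        by (auto simp: coord_space_def in_keys_iff w split: if_splits)
      show "Poly_Mapping.lookup w (U t \<tau> \<xi> i) = u_val S w t \<tau> (scen S \<xi>) i"
        if "1 \<le> \<tau> \<and> \<tau> \<le> t \<and> t \<le> N_of S \<and> \<xi> \<in> Dset S (\<tau> - mu_of S + 1) \<tau> \<and> i < xdim S t" for t \<tau> \<xi> i
        using that u u_val_cong[of S w v] wv by simp
      show "Poly_Mapping.lookup w (Y t s \<xi> i) = y_val S w t s (scen S \<xi>) i"
        if "1 \<le> s \<and> s \<le> t \<and> t \<le> N_of S \<and> \<xi> \<in> Dset S (s - mu_of S + 1) s \<and> i < cdim S t" for t s \<xi> i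
        using that y y_val_cong_vars[of S w v] wv by simp
      show "z_system S w"
        unfolding z_system_def
      proof (intro ballI allI impI conjI)
        fix t i assume t: "t \<in> {1..N_of S}" and i: "i < cdim S t"
        show "z_val S w t 1 \<eta> i \<le> 0" if "\<eta> \<in> Dset S (2 - mu_of S) 0" for \<eta>
          using z[OF t i] zz[OF t i, of 1 \<eta>] that t by simp
        show "Poly_Mapping.lookup w (Y t s \<xi> i) + z_val S w t (s + 1) (restrict \<xi> {s - mu_of S + 2..s}) i
            \<le> z_val S w t s (restrict \<xi> {s - mu_of S + 1..s - 1}) i"
          if s: "s \<in> {1..t}" and \<xi>: "\<xi> \<in> Dset S (s - mu_of S + 1) s" for s \<xi>
        proof -
          have "z_val S w t (s + 1) (restrict \<xi> {s - mu_of S + 2..s}) i =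
            z t i (s + 1) (restrict \<xi> {s - mu_of S + 2..s})"
            using s Dset_restrict[OF \<xi>, of "s - mu_of S + 2" s]
            by (intro zz[OF t i]) (auto simp: algebra_simps)
          moreover have "z_val S w t s (restrict \<xi> {s - mu_of S + 1..s - 1}) i =
            z t i s (restrict \<xi> {s - mu_of S + 1..s - 1})"
            using s Dset_restrict[OF \<xi>] by (intro zz[OF t i]) auto
          moreover have "Poly_Mapping.lookup w (Y t s \<xi> i) = ?Y t i s \<xi>"
            using s t i \<xi> by (intro y) auto
          ultimately show ?thesis
            using z[OF t i] s \<xi> by simp
        qed
      qed
    qed
    then show "\<exists>w. feasible S w \<and>
        (\<forall>x\<in>vvars S. Poly_Mapping.lookup w x = Poly_Mapping.lookup v x)"
      using wv by blast
  qed
  finally show ?thesis .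
qed

section \<open>Projection onto the \<open>v\<close>-variables and equivalence of the minimization
  problems\<close>

lemma robust_iff_projection:
  assumes valid: "valid_setting S"
  shows "robust S v \<longleftrightarrow> (\<exists>w. feasible S w \<and> coord_proj (vvars S) w = v)"
proof -
  note fin = finite_system(2)[OF valid]
  have "robust S v \<longleftrightarrow> v \<in> coord_space (vvars S) \<and>
    (\<exists>w. feasible S w \<and> (\<forall>x\<in>vvars S. Poly_Mapping.lookup w x = Poly_Mapping.lookup v x))"
    unfolding robust_def satisfies_on_trajectories_iff_scenarios[OF valid]
      satisfies_on_scenarios_iff_feasible[OF valid] ..
  also have "\<dots> \<longleftrightarrow> (\<exists>w. feasible S w \<and> coord_proj (vvars S) w = v)"
    using coord_proj_eq_iff[OF fin] coord_proj_in_coord_space[OF fin] by metis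
  finally show ?thesis .
qed

text \<open>The set of \<open>R\<close> is the image of that of \<open>F\<close> under
  \<open>p\<close>, so both problems attain the same objective values. Infima in the extended reals
  include the infeasible and the unbounded case.\<close>

lemma minimization_over_projection:
  fixes f :: "'a \<Rightarrow> real" and p :: "'b \<Rightarrow> 'a"
  assumes R: "\<And>v. R v \<longleftrightarrow> (\<exists>w. F w \<and> p w = v)"
  shows "(INF v\<in>{v. R v}. ereal (f v)) = (INF w\<in>{w. F w}. ereal (f (p w)))"
    and "F w \<Longrightarrow> is_arg_min (\<lambda>w. f (p w)) F w \<longleftrightarrow> is_arg_min f R (p w)"
    and "is_arg_min f R v \<longleftrightarrow> (\<exists>w. is_arg_min (\<lambda>w. f (p w)) F w \<and> p w = v)"
proof -
  have "{v. R v} = p ` {w. F w}"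
    using R by auto
  then show "(INF v\<in>{v. R v}. ereal (f v)) = (INF w\<in>{w. F w}. ereal (f (p w)))"
    by (simp add: image_image)
  show "F w \<Longrightarrow> is_arg_min (\<lambda>w. f (p w)) F w \<longleftrightarrow> is_arg_min f R (p w)"
    "is_arg_min f R v \<longleftrightarrow> (\<exists>w. is_arg_min (\<lambda>w. f (p w)) F w \<and> p w = v)"
    using R by (auto simp: is_arg_min_def)
qed

theorem mainTheorem2:
  shows
  "(\<forall>S::setting. valid_setting S \<longrightarrow>
      (\<forall>v\<in>coord_space (vvars S).
         satisfies_on S v (trajectories S) \<longleftrightarrow> satisfies_on S v (scenario_trajectories S)) \<and>
      (\<forall>v\<in>coord_space (vvars S).
         satisfies_on S v (trajectories S) \<longleftrightarrow>
         (\<exists>w. feasible S w \<and> (\<forall>x\<in>vvars S. Poly_Mapping.lookup w x = Poly_Mapping.lookup v x))) \<and>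
      (\<forall>f. convex_on (coord_space (vvars S)) f \<longrightarrow>
         (INF v\<in>{v. robust S v}. ereal (f v)) =
           (INF w\<in>{w. feasible S w}. ereal (f (coord_proj (vvars S) w))) \<and>
         (\<forall>w. feasible S w \<longrightarrow>
            (is_arg_min (\<lambda>w. f (coord_proj (vvars S) w)) (feasible S) w \<longleftrightarrow>
             is_arg_min f (robust S) (coord_proj (vvars S) w))) \<and>
         (\<forall>v. is_arg_min f (robust S) v \<longleftrightarrow>
            (\<exists>w. is_arg_min (\<lambda>w. f (coord_proj (vvars S) w)) (feasible S) w \<and>
                 coord_proj (vvars S) w = v)))) \<and>
   (\<exists>C::real. \<forall>(S::setting) (d::nat) (m::nat) (n::nat).
      valid_setting S \<and>
      (\<forall>t\<in>{1..N_of S}. nscen S t \<le> d \<and> cdim S t \<le> m \<and> xdim S t \<le> n) \<longrightarrow>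
      finite (svars S) \<and> finite (labels S) \<and>
      real (card (svars S)) \<le> C * (real m + real n) * real (horizon S) ^ 2 * real d ^ memory S \<and>
      real (card (labels S)) \<le> C * (real m + real n) * real (horizon S) ^ 2 * real d ^ memory S)"
proof ((intro conjI allI impI ballI; (elim conjE)?), goal_cases)
  case (1 S v)
  then show ?case by (intro satisfies_on_trajectories_iff_scenarios)
next
  case (2 S v)
  then show ?case
    by (simp add: satisfies_on_trajectories_iff_scenarios satisfies_on_scenarios_iff_feasible)
next
  case (3 S f)
  then show ?case by (intro minimization_over_projection(1) robust_iff_projection)
next
  case (4 S f w)
  then show ?case by (intro minimization_over_projection(2) robust_iff_projection)
next
  case (5 S f v)
  then show ?case by (intro minimization_over_projection(3) robust_iff_projection)
next
  case 6
  show ?case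
  \<comment> \<open>The constant 4 of \<open>card_system\<close> serves all settings at
    once.\<close>
  proof (intro exI[of _ 4] allI impI; elim conjE)
    fix S :: setting and d m n :: nat
    assume "valid_setting S"
      "\<forall>t\<in>{1..N_of S}. nscen S t \<le> d \<and> cdim S t \<le> m \<and> xdim S t \<le> n"
    then have "finite (svars S) \<and> card (svars S) \<le> 4 * ((m + n) * ((horizon S)\<^sup>2 * d ^ memory S)) \<and>
      finite (labels S) \<and> card (labels S) \<le> 4 * ((m + n) * ((horizon S)\<^sup>2 * d ^ memory S))"
      by (intro card_system) auto
    moreover have "real (4 * ((m + n) * ((horizon S)\<^sup>2 * d ^ memory S))) =
      4 * (real m + real n) * real (horizon S) ^ 2 * real d ^ memory S"
      by simp
    ultimately show "finite (svars S) \<and> finite (labels S) \<and>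
      real (card (svars S)) \<le> 4 * (real m + real n) * real (horizon S) ^ 2 * real d ^ memory S \<and>
      real (card (labels S)) \<le> 4 * (real m + real n) * real (horizon S) ^ 2 * real d ^ memory S"
      by (metis of_nat_mono)
  qed
qed

end
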